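(* Let $f\in\mathbb{R}^{d_1\times\cdots\times d_m}$, $f\ge0$, be weakly irreducible and $1<p_1,\ldots,p_m<\infty$ such that there is $i\in[m]$ with $(m-1)p_i'\le p_k$ for all $k\in[m]\setminus\{i\}$, where, if $m=2$, $i$ is chosen so that $p_i\le p_k$ for $k\in[2]\setminus\{i\}$. Let $\mathbf x^*\in\mathcal S^{d-d_i}$ be the unique strictly positive critical point of $Q_i$ in $\mathcal S^{d-d_i}_{++}$, and let $(\lambda_-^k)_{k\in\mathbb N}$, $(\lambda_+^k)_{k\in\mathbb N}\subset\mathbb{R}$ and $(\mathbf x^k)_{k\in\mathbb N}\subset\mathcal S^{d-d_i}$ be the sequences produced by HGPM with this index $i$. Then $(\mathbf x^k)$ converges to $\mathbf x^*$; $(\lambda_-^k)$, $(\lambda_+^k)$ and $(Q_i(\mathbf x^k))$ converge to $\|f\|_{p_1,\ldots,p_m}$; and there exist a norm $\|\cdot\|_G$ on $\mathcal R^{d-d_i}$, $0<\nu<1$ and $k_0\in\mathbb N$ such that $\|\mathbf x^{k+1}-\mathbf x^*\|_G\le\nu\|\mathbf x^k-\mathbf x^*\|_G$ for all $k\ge k_0$.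
   Context: $f$ is identified with the multilinear form $f(\mathbf x)=\sum f_{j_1,\ldots,j_m}x_{1,j_1}\cdots x_{m,j_m}$ on $\prod_k\mathbb{R}^{d_k}$; $\nabla_kf(\mathbf x)$ is the vector of partials $\partial f/\partial x_{k,j_k}$ (independent of $\mathbf x_k$, so $\nabla_if$ is defined on $\mathcal R^{d-d_i}=\prod_{k\ne i}\mathbb{R}^{d_k}$). $p'=p/(p-1)$; $\psi_q(\mathbf y)_j=|y_j|^{q-1}\mathrm{sign}(y_j)$. $\mathcal S^{d-d_i}$ (resp. $\mathcal S^{d-d_i}_{++}$) is the set of (entrywise positive) $\mathbf x\in\mathcal R^{d-d_i}$ with $\|\mathbf x_k\|_{p_k}=1$ for all $k\ne i$. $\|f\|_{p_1,\ldots,p_m}=\max|f(\mathbf x)|/\prod_k\|\mathbf x_k\|_{p_k}$; $Q_i(\mathbf x)=\|\nabla_if(\mathbf x)\|_{p_i'}/\prod_{k\ne i}\|\mathbf x_k\|_{p_k}$. For $k\ne i$, $s_{i,k}(\mathbf x)=\psi_{p_k'}\big(\nabla_kf(\mathbf x_1,\ldots,\mathbf x_{i-1},\psi_{p_i'}(\nabla_if(\mathbf x)),\mathbf x_{i+1},\ldots,\mathbf x_m)\big)$. HGPM with index $i$ and starting point $\mathbf x^0\in\mathcal S^{d-d_i}_{++}$: for $k=0,1,\dots$, $\mathbf z^k=(s_{i,l}(\mathbf x^k))_{l\ne i}$, $\lambda_-^{k+1}=\prod_{l\ne i}\min_{j_l}(z^k_{l,j_l}/x^k_{l,j_l})^{(p_l-1)/(p_i'(m-1))}$,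 $\lambda_+^{k+1}=\prod_{l\ne i}\max_{j_l}(z^k_{l,j_l}/x^k_{l,j_l})^{(p_l-1)/(p_i'(m-1))}$, $\mathbf x^{k+1}=(\mathbf z^k_l/\|\mathbf z^k_l\|_{p_l})_{l\ne i}$ (iterated indefinitely). Weak irreducibility: the undirected graph on $\bigcup_k\{k\}\times[d_k]$ with $(k,j_k)\sim(l,j_l)$ ($k\ne l$) iff $f_{j_1,\ldots,j_m}>0$ for some choice of the remaining indices, is connected. *)

theory Defs
  imports Complex_Main "HOL-Library.FuncSet"
begin

text \<open>Modes are 0..<m, mode k has indices 0..<d k. A tensor is a function on
multi-indices J (with J k < d k for k < m). A point of prod_k R^{d_k} is a
function x :: nat => nat => real, x k j being the coordinate x_{k,j}.\<close>

type_synonym point = "nat \<Rightarrow> nat \<Rightarrow> real"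

definition multi_idx :: "nat \<Rightarrow> (nat \<Rightarrow> nat) \<Rightarrow> (nat \<Rightarrow> nat) set" where
  "multi_idx m d = PiE {..<m} (\<lambda>k. {..<d k})"

definition hoelder_conj :: "real \<Rightarrow> real" where
  "hoelder_conj p = p / (p - 1)"

definition pnorm :: "real \<Rightarrow> nat \<Rightarrow> (nat \<Rightarrow> real) \<Rightarrow> real" where
  "pnorm p n v = (\<Sum>j<n. \<bar>v j\<bar> powr p) powr (1 / p)"

definition psi :: "real \<Rightarrow> (nat \<Rightarrow> real) \<Rightarrow> (nat \<Rightarrow> real)" where
  "psi q v = (\<lambda>j. \<bar>v j\<bar> powr (q - 1) * sgn (v j))"

text \<open>The multilinear form f(x).\<close>
definition feval :: "((nat \<Rightarrow> nat) \<Rightarrow> real) \<Rightarrow> nat \<Rightarrow> (nat \<Rightarrow> nat) \<Rightarrow> point \<Rightarrow> real" where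
  "feval f m d x = (\<Sum>J\<in>multi_idx m d. f J * (\<Prod>k<m. x k (J k)))"

text \<open>Partial gradient nabla_k f(x), a vector indexed by j < d k (independent of x k).\<close>
definition grad :: "((nat \<Rightarrow> nat) \<Rightarrow> real) \<Rightarrow> nat \<Rightarrow> (nat \<Rightarrow> nat) \<Rightarrow> nat \<Rightarrow> point \<Rightarrow> (nat \<Rightarrow> real)" where
  "grad f m d k x = (\<lambda>j. \<Sum>J\<in>{J\<in>multi_idx m d. J k = j}. f J * (\<Prod>l\<in>{..<m}-{k}. x l (J l)))"

text \<open>The space R^{d-d_i}: points supported on modes k < m, k \<noteq> i.\<close>
definition space_R :: "nat \<Rightarrow> (nat \<Rightarrow> nat) \<Rightarrow> nat \<Rightarrow> point set" where
  "space_R m d i = {x. \<forall>k j. (k \<ge> m \<or> k = i \<or> j \<ge> d k) \<longrightarrow> x k j = 0}"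

text \<open>The full space prod_k R^{d_k}.\<close>
definition space_full :: "nat \<Rightarrow> (nat \<Rightarrow> nat) \<Rightarrow> point set" where
  "space_full m d = {x. \<forall>k j. (k \<ge> m \<or> j \<ge> d k) \<longrightarrow> x k j = 0}"

definition sphere_S :: "nat \<Rightarrow> (nat \<Rightarrow> nat) \<Rightarrow> (nat \<Rightarrow> real) \<Rightarrow> nat \<Rightarrow> point set" where
  "sphere_S m d p i = {x \<in> space_R m d i. \<forall>k<m. k \<noteq> i \<longrightarrow> pnorm (p k) (d k) (x k) = 1}"

definition sphere_Spp :: "nat \<Rightarrow> (nat \<Rightarrow> nat) \<Rightarrow> (nat \<Rightarrow> real) \<Rightarrow> nat \<Rightarrow> point set" where
  "sphere_Spp m d p i = {x \<in> sphere_S m d p i. \<forall>k<m. k \<noteq> i \<longrightarrow> (\<forall>j<d k. x k j > 0)}"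

text \<open>The norm ||f||_{p_1,...,p_m} (the max is attained; we write Sup).\<close>
definition tnorm :: "((nat \<Rightarrow> nat) \<Rightarrow> real) \<Rightarrow> nat \<Rightarrow> (nat \<Rightarrow> nat) \<Rightarrow> (nat \<Rightarrow> real) \<Rightarrow> real" where
  "tnorm f m d p = Sup {\<bar>feval f m d x\<bar> / (\<Prod>k<m. pnorm (p k) (d k) (x k)) | x.
      x \<in> space_full m d \<and> (\<forall>k<m. \<exists>j<d k. x k j \<noteq> 0)}"

definition Qfun :: "((nat \<Rightarrow> nat) \<Rightarrow> real) \<Rightarrow> nat \<Rightarrow> (nat \<Rightarrow> nat) \<Rightarrow> (nat \<Rightarrow> real) \<Rightarrow> nat \<Rightarrow> point \<Rightarrow> real" where
  "Qfun f m d p i x = pnorm (hoelder_conj (p i)) (d i) (grad f m d i x)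
      / (\<Prod>k\<in>{..<m}-{i}. pnorm (p k) (d k) (x k))"

text \<open>Critical point: all partial derivatives of Q_i (w.r.t. coordinates x_{k,j},
k \<noteq> i) exist and vanish.\<close>
definition critical_Q :: "((nat \<Rightarrow> nat) \<Rightarrow> real) \<Rightarrow> nat \<Rightarrow> (nat \<Rightarrow> nat) \<Rightarrow> (nat \<Rightarrow> real) \<Rightarrow> nat \<Rightarrow> point \<Rightarrow> bool" where
  "critical_Q f m d p i x = (\<forall>k<m. k \<noteq> i \<longrightarrow> (\<forall>j<d k.
      ((\<lambda>t. Qfun f m d p i (x(k := (x k)(j := x k j + t)))) has_real_derivative 0) (at 0)))"

definition s_map :: "((nat \<Rightarrow> nat) \<Rightarrow> real) \<Rightarrow> nat \<Rightarrow> (nat \<Rightarrow> nat) \<Rightarrow> (nat \<Rightarrow> real) \<Rightarrow> nat \<Rightarrow> nat \<Rightarrow> point \<Rightarrow> (nat \<Rightarrow> real)" where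
  "s_map f m d p i k x = psi (hoelder_conj (p k))
      (grad f m d k (x(i := psi (hoelder_conj (p i)) (grad f m d i x))))"

text \<open>One HGPM step: x^{k+1} = (z_l / ||z_l||_{p_l})_{l \<noteq> i}, z = (s_{i,l}(x))_{l \<noteq> i}.\<close>
definition hgpm_step :: "((nat \<Rightarrow> nat) \<Rightarrow> real) \<Rightarrow> nat \<Rightarrow> (nat \<Rightarrow> nat) \<Rightarrow> (nat \<Rightarrow> real) \<Rightarrow> nat \<Rightarrow> point \<Rightarrow> point" where
  "hgpm_step f m d p i x = (\<lambda>l j. if l < m \<and> l \<noteq> i \<and> j < d l
      then s_map f m d p i l x j / pnorm (p l) (d l) (s_map f m d p i l x) else 0)"

primrec hgpm_x :: "((nat \<Rightarrow> nat) \<Rightarrow> real) \<Rightarrow> nat \<Rightarrow> (nat \<Rightarrow> nat) \<Rightarrow> (nat \<Rightarrow> real) \<Rightarrow> nat \<Rightarrow> point \<Rightarrow> nat \<Rightarrow> point" where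
  "hgpm_x f m d p i x0 0 = x0"
| "hgpm_x f m d p i x0 (Suc n) = hgpm_step f m d p i (hgpm_x f m d p i x0 n)"

text \<open>hgpm_lam_minus ... (x^k) is lambda_-^{k+1}; similarly for lambda_+.\<close>
definition hgpm_lam_minus :: "((nat \<Rightarrow> nat) \<Rightarrow> real) \<Rightarrow> nat \<Rightarrow> (nat \<Rightarrow> nat) \<Rightarrow> (nat \<Rightarrow> real) \<Rightarrow> nat \<Rightarrow> point \<Rightarrow> real" where
  "hgpm_lam_minus f m d p i x = (\<Prod>l\<in>{..<m}-{i}.
     Min ((\<lambda>j. (s_map f m d p i l x j / x l j) powr ((p l - 1) / (hoelder_conj (p i) * (real m - 1)))) ` {..<d l}))"

definition hgpm_lam_plus :: "((nat \<Rightarrow> nat) \<Rightarrow> real) \<Rightarrow> nat \<Rightarrow> (nat \<Rightarrow> nat) \<Rightarrow> (nat \<Rightarrow> real) \<Rightarrow> nat \<Rightarrow> point \<Rightarrow> real" where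
  "hgpm_lam_plus f m d p i x = (\<Prod>l\<in>{..<m}-{i}.
     Max ((\<lambda>j. (s_map f m d p i l x j / x l j) powr ((p l - 1) / (hoelder_conj (p i) * (real m - 1)))) ` {..<d l}))"

text \<open>Weak irreducibility: connectivity of the graph on {(k,j). k<m, j<d k}.\<close>
definition wi_edges :: "((nat \<Rightarrow> nat) \<Rightarrow> real) \<Rightarrow> nat \<Rightarrow> (nat \<Rightarrow> nat) \<Rightarrow> ((nat \<times> nat) \<times> (nat \<times> nat)) set" where
  "wi_edges f m d = {((k, a), (l, b)). k < m \<and> l < m \<and> k \<noteq> l \<and>
      (\<exists>J\<in>multi_idx m d. J k = a \<and> J l = b \<and> f J > 0)}"

definition weakly_irreducible :: "((nat \<Rightarrow> nat) \<Rightarrow> real) \<Rightarrow> nat \<Rightarrow> (nat \<Rightarrow> nat) \<Rightarrow> bool" where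
  "weakly_irreducible f m d = (\<forall>u\<in>{(k, j). k < m \<and> j < d k}. \<forall>v\<in>{(k, j). k < m \<and> j < d k}.
      (u, v) \<in> (wi_edges f m d)\<^sup>*)"

text \<open>A norm on a linear subspace V of point (pointwise operations).\<close>
definition is_norm_on :: "point set \<Rightarrow> (point \<Rightarrow> real) \<Rightarrow> bool" where
  "is_norm_on V N = ((\<forall>x\<in>V. N x \<ge> 0 \<and> (N x = 0 \<longleftrightarrow> x = (\<lambda>k j. 0))) \<and>
     (\<forall>x\<in>V. \<forall>c. N (\<lambda>k j. c * x k j) = \<bar>c\<bar> * N x) \<and>
     (\<forall>x\<in>V. \<forall>y\<in>V. N (\<lambda>k j. x k j + y k j) \<le> N x + N y))"

end

theory Submission
  imports Defs "HOL-Analysis.L2_Norm"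
begin

text \<open>Let \<open>x*\<close> be the critical point. Extending it by \<open>\<psi>\<^bsub>p_i'\<^esub>(\<nabla>\<^sub>i f(x*))\<close> in mode \<open>i\<close> turns the terms of
  the multilinear form into a distribution \<open>W\<close> on multi-indices, and criticality says that its
  \<open>k\<close>-th marginal is proportional to \<open>x*\<^sub>k\<close> raised to the power \<open>p\<^sub>k\<close>. Hence \<open>x*\<close> is a fixed point of the
  iteration, and the weighted AM-GM inequality (with \<open>\<Sum> 1/p\<^sub>k \<le> 1\<close>) shows that it attains the norm of \<open>f\<close>.

  In logarithmic coordinates the linearised iteration at \<open>x*\<close> is built from conditional expectations
  with respect to \<open>W\<close>. Jensen's inequality makes it a contraction for a weighted Euclidean norm;
  equality forces a direction to be constant along the edges of the graph of \<open>f\<close>, hence constant by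
  weak irreducibility, hence zero because it is tangent to the spheres. So the iteration contracts
  near \<open>x*\<close> in that norm.

  The iteration does not increase the Hilbert projective distance in the worst mode, since its
  homogeneity matrix has row sums \<open>((m-1)p\<^sub>i'-1)/(p\<^sub>k-1) \<le> 1\<close>. A nonexpansive map with a locally
  attracting fixed point attracts every point that can be joined to it by short steps, which gives
  global convergence.\<close>

section \<open>Logarithmic derivatives along sequences\<close>

text \<open>Differences of logarithms are taken along a sequence, so that one calculus serves both
  explicit perturbations and the sequence produced by compactness in
  \<open>local_contraction\<close>. Positivity is built in because \<open>ln\<close> needs it at
  every term.\<close>

definition log_deriv :: "(nat \<Rightarrow> real) \<Rightarrow> (nat \<Rightarrow> real) \<Rightarrow> real \<Rightarrow> real \<Rightarrow> bool" where
  "log_deriv e A a r \<longleftrightarrow> 0 < a \<and> (\<forall>n. 0 < A n) \<and> (\<lambda>n. (ln (A n) - ln a) / e n) \<longlonglongrightarrow> r"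

lemma log_deriv_pos: "log_deriv e A a r \<Longrightarrow> 0 < a" "log_deriv e A a r \<Longrightarrow> 0 < A n"
  by (auto simp: log_deriv_def)

lemma log_deriv_const: "0 < a \<Longrightarrow> log_deriv e (\<lambda>_. a) a 0"
  by (simp add: log_deriv_def)

lemma log_deriv_mult:
  assumes "log_deriv e A a r" "log_deriv e B b s"
  shows "log_deriv e (\<lambda>n. A n * B n) (a * b) (r + s)"
proof -
  have "(\<lambda>n. (ln (A n) - ln a) / e n + (ln (B n) - ln b) / e n) \<longlonglongrightarrow> r + s"
    using assms by (intro tendsto_add) (auto simp: log_deriv_def)
  moreover have "(ln (A n * B n) - ln (a * b)) / e n = (ln (A n) - ln a) / e n + (ln (B n) - ln b) / e n" for n
    using log_deriv_pos(1)[OF assms(1)] log_deriv_pos(1)[OF assms(2)]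
      log_deriv_pos(2)[OF assms(1), of n] log_deriv_pos(2)[OF assms(2), of n]
    by (simp add: ln_mult diff_divide_distrib add_divide_distrib)
  ultimately show ?thesis using assms by (auto simp: log_deriv_def)
qed

lemma log_deriv_divide:
  assumes "log_deriv e A a r" "log_deriv e B b s"
  shows "log_deriv e (\<lambda>n. A n / B n) (a / b) (r - s)"
proof -
  have "(\<lambda>n. (ln (A n) - ln a) / e n - (ln (B n) - ln b) / e n) \<longlonglongrightarrow> r - s"
    using assms by (intro tendsto_diff) (auto simp: log_deriv_def)
  moreover have "(ln (A n / B n) - ln (a / b)) / e n = (ln (A n) - ln a) / e n - (ln (B n) - ln b) / e n" for n
    using log_deriv_pos(1)[OF assms(1)] log_deriv_pos(1)[OF assms(2)]
      log_deriv_pos(2)[OF assms(1), of n] log_deriv_pos(2)[OF assms(2), of n]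
    by (simp add: ln_div diff_divide_distrib)
  ultimately show ?thesis using assms by (auto simp: log_deriv_def)
qed

lemma log_deriv_powr:
  assumes "log_deriv e A a r"
  shows "log_deriv e (\<lambda>n. A n powr c) (a powr c) (c * r)"
proof -
  have "(\<lambda>n. c * ((ln (A n) - ln a) / e n)) \<longlonglongrightarrow> c * r"
    using assms by (intro tendsto_mult_left) (auto simp: log_deriv_def)
  moreover have "(ln (A n powr c) - ln (a powr c)) / e n = c * ((ln (A n) - ln a) / e n)" for n
    using log_deriv_pos(1)[OF assms(1)] log_deriv_pos(2)[OF assms(1), of n]
    by (simp add: ln_powr right_diff_distrib)
  ultimately have "(\<lambda>n. (ln (A n powr c) - ln (a powr c)) / e n) \<longlonglongrightarrow> c * r" by presburger
  moreover have "0 < a powr c" "\<forall>n. 0 < A n powr c"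
    using log_deriv_pos[OF assms] by (simp_all add: less_imp_neq[symmetric])
  ultimately show ?thesis by (simp only: log_deriv_def) simp
qed

lemma log_deriv_prod:
  assumes "finite S" "\<And>s. s \<in> S \<Longrightarrow> log_deriv e (A s) (a s) (r s)"
  shows "log_deriv e (\<lambda>n. \<Prod>s\<in>S. A s n) (\<Prod>s\<in>S. a s) (\<Sum>s\<in>S. r s)"
  using assms
proof (induction S rule: finite_induct)
  case empty
  then show ?case by (simp add: log_deriv_const)
next
  case (insert x F)
  then show ?case by (simp add: log_deriv_mult)
qed

lemma log_deriv_cong:
  assumes "log_deriv e A a r" "\<And>n. A n = B n" "a = b" "r = s"
  shows "log_deriv e B b s"
proof -
  have "A = B" using assms(2) by auto
  with assms show ?thesis by simp
qed

text \<open>Caratheodory's form of the derivative, with a factor \<open>k\<close> continuous at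
  \<open>b\<close>, avoids dividing by \<open>B n - b\<close>, which may be zero.\<close>

lemma difference_quotient_chain:
  fixes B :: "nat \<Rightarrow> real"
  assumes e: "e \<longlonglongrightarrow> 0" "\<And>n. e n \<noteq> 0" and B: "(\<lambda>n. (B n - b) / e n) \<longlonglongrightarrow> r"
    and g: "(g has_real_derivative D) (at b)"
  shows "(\<lambda>n. (g (B n) - g b) / e n) \<longlonglongrightarrow> D * r"
proof -
  obtain k where k: "\<And>z. g z - g b = k z * (z - b)" "isCont k b" "k b = D"
    using g unfolding CARAT_DERIV by blast
  have "(\<lambda>n. (B n - b) / e n * e n) \<longlonglongrightarrow> r * 0" by (intro tendsto_mult B e)
  then have "(\<lambda>n. B n - b) \<longlonglongrightarrow> 0" using e(2) by simp
  then have "B \<longlonglongrightarrow> b" by (simp add: LIM_zero_iff)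
  then have "(\<lambda>n. k (B n)) \<longlonglongrightarrow> D" using k(2,3) isCont_tendsto_compose by blast
  then have "(\<lambda>n. k (B n) * ((B n - b) / e n)) \<longlonglongrightarrow> D * r" by (intro tendsto_mult B)
  then show ?thesis by (simp add: k(1))
qed

text \<open>Both \<open>ln\<close> at 1 and \<open>exp\<close> at 0 have derivative 1, so the chain
  rule works in either direction. Logarithms suit products; relative increments suit sums.\<close>

lemma log_deriv_iff_relative:
  assumes e: "e \<longlonglongrightarrow> 0" "\<And>n. e n \<noteq> 0" and pos: "0 < a" "\<And>n. 0 < A n"
  shows "log_deriv e A a r \<longleftrightarrow> (\<lambda>n. (A n / a - 1) / e n) \<longlonglongrightarrow> r"
proof -
  have *: "log_deriv e A a r \<longleftrightarrow> (\<lambda>n. (ln (A n / a) - ln 1) / e n) \<longlonglongrightarrow> r"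
    using pos by (simp add: log_deriv_def ln_div less_imp_neq[symmetric])
  show ?thesis
  proof
    assume "log_deriv e A a r"
    then have "(\<lambda>n. (ln (A n / a) - 0) / e n) \<longlonglongrightarrow> r" using * by simp
    from difference_quotient_chain[OF e this, of exp 1] show "(\<lambda>n. (A n / a - 1) / e n) \<longlonglongrightarrow> r"
      using pos DERIV_exp[of "0::real"] by simp
  next
    assume "(\<lambda>n. (A n / a - 1) / e n) \<longlonglongrightarrow> r"
    from difference_quotient_chain[OF e this, of ln 1] show "log_deriv e A a r"
      unfolding * using DERIV_ln[of "1::real"] by simp
  qed
qed

text \<open>The relative increment of a sum is the mean of the relative increments of its terms with
  weights \<open>c s * a s\<close>. These weights are the source of the conditional expectations
  below. The index \<open>t\<close> makes the sums positive.\<close>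

lemma log_deriv_weighted_sum:
  assumes e: "e \<longlonglongrightarrow> 0" "\<And>n. e n \<noteq> 0" and "finite S"
    and ld: "\<And>s. s \<in> S \<Longrightarrow> log_deriv e (A s) (a s) (r s)"
    and c: "\<And>s. s \<in> S \<Longrightarrow> 0 \<le> c s" and t: "t \<in> S" "0 < c t"
  shows "log_deriv e (\<lambda>n. \<Sum>s\<in>S. c s * A s n) (\<Sum>s\<in>S. c s * a s)
           ((\<Sum>s\<in>S. c s * a s * r s) / (\<Sum>s\<in>S. c s * a s))"
proof -
  let ?a = "\<Sum>s\<in>S. c s * a s"
  have a: "0 < ?a"
    using log_deriv_pos(1)[OF ld] c t by (intro sum_pos2[OF \<open>finite S\<close> t(1)]) (auto simp: less_imp_le)
  have An: "0 < (\<Sum>s\<in>S. c s * A s n)" for n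
    using log_deriv_pos(2)[OF ld] c t by (intro sum_pos2[OF \<open>finite S\<close> t(1)]) (auto simp: less_imp_le)
  have "(\<lambda>n. (\<Sum>s\<in>S. c s * a s * ((A s n / a s - 1) / e n)) / ?a) \<longlonglongrightarrow> (\<Sum>s\<in>S. c s * a s * r s) / ?a"
  proof (intro tendsto_divide tendsto_sum tendsto_mult_left tendsto_const)
    fix s assume "s \<in> S"
    from ld[OF this] show "(\<lambda>n. (A s n / a s - 1) / e n) \<longlonglongrightarrow> r s"
      using log_deriv_iff_relative[OF e] log_deriv_pos by blast
  qed (use a in simp)
  moreover have "(\<Sum>s\<in>S. c s * a s * ((A s n / a s - 1) / e n)) / ?a = ((\<Sum>s\<in>S. c s * A s n) / ?a - 1) / e n" for n
  proof -
    have "(\<Sum>s\<in>S. c s * a s * ((A s n / a s - 1) / e n)) = (\<Sum>s\<in>S. (c s * A s n - c s * a s) / e n)"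
    proof (intro sum.cong refl)
      fix s assume "s \<in> S"
      then have "a s > 0" using ld log_deriv_pos by blast
      then show "c s * a s * ((A s n / a s - 1) / e n) = (c s * A s n - c s * a s) / e n"
        using e(2)[of n] by (simp add: field_simps)
    qed
    also have "\<dots> = ((\<Sum>s\<in>S. c s * A s n) - ?a) / e n"
      by (simp add: sum_divide_distrib[symmetric] sum_subtractf)
    finally show ?thesis using a by (simp add: diff_divide_distrib)
  qed
  ultimately show ?thesis using log_deriv_iff_relative[OF e a An] by simp
qed

text \<open>The factor \<open>s\<close> from the inner powers cancels the outer exponent
  \<open>1 / s\<close>, which leaves a mean with weights \<open>a j powr s\<close>.\<close>

lemma log_deriv_pnorm:
  assumes e: "e \<longlonglongrightarrow> 0" "\<And>n. e n \<noteq> 0" and "0 < N" "0 < s"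
    and ld: "\<And>j. j < N \<Longrightarrow> log_deriv e (\<lambda>n. A n j) (a j) (r j)"
  shows "log_deriv e (\<lambda>n. pnorm s N (A n)) (pnorm s N a)
           ((\<Sum>j<N. a j powr s * r j) / (\<Sum>j<N. a j powr s))"
proof -
  have "log_deriv e (\<lambda>n. \<Sum>j<N. 1 * (A n j powr s)) (\<Sum>j<N. 1 * a j powr s)
     ((\<Sum>j<N. 1 * a j powr s * (s * r j)) / (\<Sum>j<N. 1 * a j powr s))"
    by (rule log_deriv_weighted_sum[OF e, where t = 0]) (use assms in \<open>auto intro: log_deriv_powr\<close>)
  then have "log_deriv e (\<lambda>n. (\<Sum>j<N. A n j powr s) powr (1/s)) ((\<Sum>j<N. a j powr s) powr (1/s))
     (1 / s * ((\<Sum>j<N. a j powr s * (s * r j)) / (\<Sum>j<N. a j powr s)))"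
    unfolding mult_1 by (rule log_deriv_powr)
  then show ?thesis
  proof (rule log_deriv_cong)
    show "(\<Sum>j<N. A n j powr s) powr (1 / s) = pnorm s N (A n)" for n
      unfolding pnorm_def using log_deriv_pos(2)[OF ld, of _ n] by (auto simp: less_imp_le intro!: arg_cong2[where f = "(powr)"] sum.cong)
    show "(\<Sum>j<N. a j powr s) powr (1 / s) = pnorm s N a"
      unfolding pnorm_def using log_deriv_pos(1)[OF ld] by (auto simp: less_imp_le intro!: arg_cong2[where f = "(powr)"] sum.cong)
    have "(\<Sum>j<N. a j powr s * (s * r j)) = s * (\<Sum>j<N. a j powr s * r j)"
      by (simp add: sum_distrib_left mult_ac)
    then show "1 / s * ((\<Sum>j<N. a j powr s * (s * r j)) / (\<Sum>j<N. a j powr s)) =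
      (\<Sum>j<N. a j powr s * r j) / (\<Sum>j<N. a j powr s)" using \<open>0 < s\<close> by simp
  qed
qed

section \<open>Subsequences and weighted means\<close>

text \<open>Each induction step thins the current subsequence to one that is monotone for the new
  member; thinning preserves the limits already obtained.\<close>

lemma convergent_subsequence_finite_family:
  fixes A :: "'b \<Rightarrow> nat \<Rightarrow> real"
  assumes "finite B" "\<And>b. b \<in> B \<Longrightarrow> Bseq (A b)"
  shows "\<exists>\<sigma>. strict_mono (\<sigma> :: nat \<Rightarrow> nat) \<and> (\<forall>b\<in>B. convergent (A b \<circ> \<sigma>))"
  using assms
proof (induction B rule: finite_induct)
  case empty
  then show ?case using strict_mono_id by blast
next
  case (insert b F)
  then obtain \<sigma> :: "nat \<Rightarrow> nat" where s: "strict_mono \<sigma>" "\<forall>b\<in>F. convergent (A b \<circ> \<sigma>)" by blast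
  obtain \<tau> where t: "strict_mono \<tau>" "monoseq (\<lambda>n. (A b \<circ> \<sigma>) (\<tau> n))"
    using seq_monosub by blast
  have "Bseq (\<lambda>n. (A b \<circ> \<sigma>) (\<tau> n))"
    using insert.prems[of b] by (auto simp: Bseq_def)
  then have "convergent (A b \<circ> (\<sigma> \<circ> \<tau>))"
    using Bseq_monoseq_convergent t(2) by (simp add: comp_def)
  moreover have "convergent (A c \<circ> (\<sigma> \<circ> \<tau>))" if "c \<in> F" for c
    using convergent_subseq_convergent[OF _ t(1), of "A c \<circ> \<sigma>"] s(2) that by (simp add: comp_def)
  ultimately show ?case using strict_mono_o[OF s(1) t(1)] by blast
qed

text \<open>The deficit of the weights \<open>1 / p k\<close> is the weight of an extra number 1.
  This is Jensen's inequality for \<open>exp\<close> at the points \<open>p k * ln (r k)\<close> and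
  0, whose weighted mean is the logarithm of the product.\<close>

lemma weighted_arith_geom_mean_le:
  fixes p r :: "'a \<Rightarrow> real"
  assumes "finite S" "\<And>k. k \<in> S \<Longrightarrow> 0 \<le> r k" "\<And>k. k \<in> S \<Longrightarrow> 0 < p k" "(\<Sum>k\<in>S. 1 / p k) \<le> 1"
  shows "(\<Prod>k\<in>S. r k) \<le> (\<Sum>k\<in>S. r k powr p k / p k) + (1 - (\<Sum>k\<in>S. 1 / p k))"
proof (cases "\<exists>k\<in>S. r k = 0")
  case True
  then have "(\<Prod>k\<in>S. r k) = 0" using assms(1) by auto
  moreover have "0 \<le> (\<Sum>k\<in>S. r k powr p k / p k)" using assms by (intro sum_nonneg) (auto simp: less_imp_le)
  ultimately show ?thesis using assms(4) by simp
next
  case False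
  with assms(2) have rp: "r k > 0" if "k \<in> S" for k using that by (metis less_eq_real_def)
  define \<sigma> where "\<sigma> = (\<Sum>k\<in>S. ln (r k))"
  define t where "t = (\<lambda>k. p k * ln (r k))"
  have prod: "(\<Prod>k\<in>S. r k) = exp \<sigma>" using rp assms(1) by (simp add: \<sigma>_def exp_sum)
  \<comment> \<open>The graph of \<open>exp\<close> lies above its tangent at \<open>\<sigma>\<close>.\<close>
  have tan: "exp \<sigma> * (1 + (u - \<sigma>)) \<le> exp u" for u
    using exp_ge_add_one_self[of "u - \<sigma>"] by (simp add: exp_diff field_simps)
  have "(\<Sum>k\<in>S. exp \<sigma> * (1 + (t k - \<sigma>)) / p k) \<le> (\<Sum>k\<in>S. r k powr p k / p k)"
  proof (intro sum_mono divide_right_mono)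
    fix k assume "k \<in> S"
    then have "r k powr p k = exp (t k)" using rp[of k] by (simp add: t_def powr_def)
    then show "exp \<sigma> * (1 + (t k - \<sigma>)) \<le> r k powr p k" using tan by simp
  qed (use assms(3) in \<open>auto simp: less_imp_le\<close>)
  moreover have "(1 - (\<Sum>k\<in>S. 1 / p k)) * (exp \<sigma> * (1 + (0 - \<sigma>))) \<le> (1 - (\<Sum>k\<in>S. 1 / p k)) * 1"
    using tan[of 0] assms(4) by (intro mult_left_mono) auto
  moreover have "(\<Sum>k\<in>S. exp \<sigma> * (1 + (t k - \<sigma>)) / p k) = exp \<sigma> * ((1 - \<sigma>) * (\<Sum>k\<in>S. 1 / p k) + \<sigma>)"
  proof -
    have "(\<Sum>k\<in>S. exp \<sigma> * (1 + (t k - \<sigma>)) / p k) = (\<Sum>k\<in>S. exp \<sigma> * ((1 - \<sigma>) * (1 / p k) + ln (r k)))"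
      using assms(3) by (intro sum.cong refl) (force simp: t_def field_simps)
    then show ?thesis by (simp only: sum_distrib_left[symmetric] sum.distrib \<sigma>_def[symmetric])
  qed
  ultimately show ?thesis unfolding prod by (simp add: algebra_simps)
qed

lemma tendsto_Min_Max_image:
  fixes g :: "nat \<Rightarrow> 'a \<Rightarrow> real"
  assumes "finite S" "S \<noteq> {}" "\<And>j. j \<in> S \<Longrightarrow> (\<lambda>n. g n j) \<longlonglongrightarrow> c"
  shows "(\<lambda>n. Min (g n ` S)) \<longlonglongrightarrow> c" "(\<lambda>n. Max (g n ` S)) \<longlonglongrightarrow> c"
proof -
  have "(\<lambda>n. Min (g n ` S)) \<longlonglongrightarrow> c \<and> (\<lambda>n. Max (g n ` S)) \<longlonglongrightarrow> c"
    using assms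
  proof (induction S rule: finite_ne_induct)
    case (insert x F)
    have "(\<lambda>n. min (g n x) (Min (g n ` F))) \<longlonglongrightarrow> min c c" "(\<lambda>n. max (g n x) (Max (g n ` F))) \<longlonglongrightarrow> max c c"
      using insert by (intro tendsto_min tendsto_max; simp)+
    then show ?case using insert.hyps by simp
  qed simp
  then show "(\<lambda>n. Min (g n ` S)) \<longlonglongrightarrow> c" "(\<lambda>n. Max (g n ` S)) \<longlonglongrightarrow> c" by auto
qed

section \<open>Weakly irreducible nonnegative tensors\<close>

lemma finite_multi_idx: "finite (multi_idx m d)"
  unfolding multi_idx_def by (intro finite_PiE) auto

lemma multi_idx_less: "J \<in> multi_idx m d \<Longrightarrow> k < m \<Longrightarrow> J k < d k"
  by (auto simp: multi_idx_def)

lemma grad_cong: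
  assumes "\<And>l j. l < m \<Longrightarrow> l \<noteq> k \<Longrightarrow> j < d l \<Longrightarrow> X l j = Y l j"
  shows "grad f m d k X = grad f m d k Y"
  unfolding grad_def using assms by (auto intro!: ext sum.cong prod.cong simp: multi_idx_less)

lemma grad_scale:
  "grad f m d k (\<lambda>l j. b l * Y l j) j = (\<Prod>l\<in>{..<m}-{k}. b l) * grad f m d k Y j"
  by (simp add: grad_def prod.distrib sum_distrib_left mult_ac)

lemma sum_multi_idx_group:
  assumes "k < m"
  shows "(\<Sum>J\<in>multi_idx m d. \<phi> J) = (\<Sum>j<d k. \<Sum>J\<in>{J\<in>multi_idx m d. J k = j}. \<phi> J)"
  by (rule sum.group[symmetric]) (use assms finite_multi_idx multi_idx_less in auto)

section \<open>Elementary facts about p-norms\<close>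

lemma pnorm_nonneg: "0 \<le> pnorm s N v"
  by (simp add: pnorm_def)

lemma pnorm_pos:
  assumes "j < N" "v j \<noteq> 0"
  shows "0 < pnorm s N v"
proof -
  have "0 < (\<Sum>j<N. \<bar>v j\<bar> powr s)" by (rule sum_pos2[where i = j]) (use assms in auto)
  then show ?thesis by (simp add: pnorm_def)
qed

lemma pnorm_powr:
  assumes "0 < s"
  shows "pnorm s N v powr s = (\<Sum>j<N. \<bar>v j\<bar> powr s)"
  using assms by (simp add: pnorm_def powr_powr sum_nonneg)

lemma pnorm_cmult:
  assumes "0 < s" "0 \<le> c"
  shows "pnorm s N (\<lambda>j. c * v j) = c * pnorm s N v"
proof -
  have "(\<Sum>j<N. \<bar>c * v j\<bar> powr s) = c powr s * (\<Sum>j<N. \<bar>v j\<bar> powr s)"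
    using assms by (simp add: abs_mult powr_mult sum_distrib_left)
  then show ?thesis using assms by (simp add: pnorm_def powr_mult powr_powr sum_nonneg)
qed

lemma pnorm_cong: "(\<And>j. j < N \<Longrightarrow> v j = w j) \<Longrightarrow> pnorm s N v = pnorm s N w"
  by (simp add: pnorm_def)

section \<open>The setting, and positivity of the iteration\<close>

locale tensor_setup =
  fixes f :: "(nat \<Rightarrow> nat) \<Rightarrow> real" and m :: nat and d :: "nat \<Rightarrow> nat"
    and p :: "nat \<Rightarrow> real" and i :: nat
  assumes m2: "m \<ge> 2"
    and dpos: "\<forall>k<m. d k \<ge> 1"
    and fnonneg: "\<forall>J\<in>multi_idx m d. f J \<ge> 0"
    and wirr: "weakly_irreducible f m d"
    and prange: "\<forall>k<m. 1 < p k"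
    and im: "i < m"
    and pcond: "\<forall>k<m. k \<noteq> i \<longrightarrow> (real m - 1) * hoelder_conj (p i) \<le> p k"
begin

abbreviation L where "L \<equiv> {..<m} - {i}"
abbreviation I where "I \<equiv> multi_idx m d"
abbreviation H where "H \<equiv> hgpm_step f m d p i"
abbreviation gr where "gr \<equiv> grad f m d"

definition q where "q = hoelder_conj (p i)"

definition positive :: "point \<Rightarrow> bool" where
  "positive x \<longleftrightarrow> (\<forall>l\<in>L. \<forall>j<d l. 0 < x l j)"

text \<open>Mode \<open>i\<close> is filled with the vector that gives equality in Hoelder's
  inequality against \<open>gr i x\<close>.\<close>

definition ext :: "point \<Rightarrow> point" where
  "ext x = x(i := psi q (gr i x))"

text \<open>This is the degree of homogeneity of \<open>gr k (ext x)\<close> in \<open>x\<close> for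
  \<open>k\<close> in \<open>L\<close>: \<open>m - 2\<close> modes contribute degree 1 each and mode
  \<open>i\<close> contributes \<open>(m - 1) * (q - 1)\<close>. By \<open>c_le\<close> the root
  taken in \<open>s_map\<close> brings the degree down to at most 1.\<close>

definition c where "c = (real m - 1) * q - 1"

lemma q_gt_1: "1 < q"
  using prange im by (simp add: q_def hoelder_conj_def)

lemma c_pos: "0 < c"
proof -
  have "1 * q \<le> (real m - 1) * q" using m2 q_gt_1 by (intro mult_right_mono) auto
  then show ?thesis using q_gt_1 unfolding c_def by linarith
qed

lemma c_le: "k \<in> L \<Longrightarrow> c \<le> p k - 1"
  using pcond by (simp add: c_def q_def)

lemma p_gt_1: "k \<in> L \<Longrightarrow> 1 < p k"
  using prange by auto

lemma finite_I: "finite I" by (rule finite_multi_idx)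

lemma d_pos: "k < m \<Longrightarrow> 0 < d k" using dpos by (simp add: Suc_le_eq)

text \<open>As \<open>m\<close> is at least 2, there is a vertex in another mode; the first edge of
  a path to it comes from a positive entry.\<close>

lemma positive_entry_through_vertex:
  assumes "k < m" "j < d k"
  shows "\<exists>J\<in>I. J k = j \<and> 0 < f J"
proof -
  obtain l where l: "l < m" "l \<noteq> k"
  proof (cases "k = 0")
    case True then show ?thesis using m2 that[of 1] by auto
  next
    case False then show ?thesis using m2 that[of 0] by auto
  qed
  have "((k, j), (l, 0)) \<in> (wi_edges f m d)\<^sup>*"
    using wirr assms l d_pos[of l] unfolding weakly_irreducible_def by blast
  moreover have "(k, j) \<noteq> (l, 0)" using l by auto
  ultimately obtain y where "((k, j), y) \<in> wi_edges f m d" by (meson converse_rtranclE)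
  then show ?thesis by (auto simp: wi_edges_def)
qed

lemma constant_along_edges_imp_constant:
  assumes edge: "\<And>J k l. J \<in> I \<Longrightarrow> 0 < f J \<Longrightarrow> k < m \<Longrightarrow> l < m \<Longrightarrow> v k (J k) = v l (J l)"
    and "k < m" "j < d k" "l < m" "j' < d l"
  shows "v k j = v l j'"
proof -
  have "((k, j), (l, j')) \<in> (wi_edges f m d)\<^sup>*"
    using wirr assms unfolding weakly_irreducible_def by blast
  then have "case_prod v (k, j) = case_prod v (l, j')"
  proof (induction rule: rtrancl_induct)
    case (step y z)
    obtain a b a' b' J where "y = (a, b)" "z = (a', b')" "a < m" "a' < m" "J \<in> I" "J a = b" "J a' = b'" "0 < f J"
      using step.hyps(2) unfolding wi_edges_def by blast
    then have "case_prod v y = case_prod v z" using edge[of J a a'] by auto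
    with step.IH show ?case by simp
  qed simp
  then show ?thesis by simp
qed

lemma grad_mono:
  assumes "\<And>l j. l < m \<Longrightarrow> l \<noteq> k \<Longrightarrow> j < d l \<Longrightarrow> 0 \<le> X l j \<and> X l j \<le> Y l j"
  shows "gr k X j \<le> gr k Y j"
  unfolding grad_def
proof (intro sum_mono mult_left_mono prod_mono)
  fix J l assume "J \<in> {J \<in> I. J k = j}" "l \<in> {..<m} - {k}"
  then show "0 \<le> X l (J l) \<and> X l (J l) \<le> Y l (J l)" using assms[of l "J l"] multi_idx_less by auto
qed (use fnonneg in auto)

lemma grad_pos:
  assumes "\<And>l j. l < m \<Longrightarrow> l \<noteq> k \<Longrightarrow> j < d l \<Longrightarrow> 0 < X l j" "k < m" "j < d k"
  shows "0 < gr k X j"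
proof -
  obtain J where J: "J \<in> I" "J k = j" "0 < f J" using positive_entry_through_vertex assms by blast
  have P: "0 < (\<Prod>l\<in>{..<m}-{k}. X l (J l))" if "J \<in> I" for J
    using assms that multi_idx_less by (intro prod_pos) auto
  show ?thesis unfolding grad_def
    by (rule sum_pos2[where i = J]) (use J P finite_I fnonneg in \<open>auto simp: less_imp_le\<close>)
qed

lemma gi_pos: "positive x \<Longrightarrow> a < d i \<Longrightarrow> 0 < gr i x a"
  using im by (intro grad_pos) (auto simp: positive_def)

lemma ext_simps:
  "l \<noteq> i \<Longrightarrow> ext x l = x l"
  "positive x \<Longrightarrow> a < d i \<Longrightarrow> ext x i a = gr i x a powr (q - 1)"
  by (auto simp: ext_def psi_def gi_pos less_imp_le sgn_if dest: gi_pos)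

lemma ext_pos: "positive x \<Longrightarrow> l < m \<Longrightarrow> j < d l \<Longrightarrow> 0 < ext x l j"
  using gi_pos[of x j] by (cases "l = i") (auto simp: ext_simps, auto simp: positive_def)

lemma grad_i_ext: "gr i (ext x) = gr i x"
  by (intro grad_cong) (simp add: ext_simps)

lemma grad_ext_pos: "positive x \<Longrightarrow> k < m \<Longrightarrow> j < d k \<Longrightarrow> 0 < gr k (ext x) j"
  by (intro grad_pos) (auto simp: ext_pos)

lemma conj_exponent: "k < m \<Longrightarrow> hoelder_conj (p k) - 1 = 1 / (p k - 1)"
  using prange by (force simp: hoelder_conj_def field_simps)

lemma s_map_eq:
  assumes "positive x" "k \<in> L" "j < d k"
  shows "s_map f m d p i k x j = gr k (ext x) j powr (1 / (p k - 1))"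
  using grad_ext_pos[OF assms(1), of k j] assms
  by (simp add: s_map_def psi_def ext_def q_def conj_exponent)

lemma s_map_pos: "positive x \<Longrightarrow> k \<in> L \<Longrightarrow> j < d k \<Longrightarrow> 0 < s_map f m d p i k x j"
  using grad_ext_pos[of x k j] by (simp add: s_map_eq)

lemma pnorm_s_map_pos: "positive x \<Longrightarrow> k \<in> L \<Longrightarrow> 0 < pnorm (p k) (d k) (s_map f m d p i k x)"
  using s_map_pos[of x k 0] d_pos by (intro pnorm_pos[of 0]) auto

lemma H_eq: "l \<in> L \<Longrightarrow> j < d l \<Longrightarrow> H x l j = s_map f m d p i l x j / pnorm (p l) (d l) (s_map f m d p i l x)"
  by (simp add: hgpm_step_def)

lemma H_Spp:
  assumes "positive x"
  shows "H x \<in> sphere_Spp m d p i"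
proof -
  have "pnorm (p k) (d k) (H x k) = 1" if "k \<in> L" for k
  proof -
    let ?N = "pnorm (p k) (d k) (s_map f m d p i k x)"
    have "pnorm (p k) (d k) (H x k) = pnorm (p k) (d k) (\<lambda>j. 1 / ?N * s_map f m d p i k x j)"
      using that by (intro pnorm_cong) (simp add: H_eq)
    also have "\<dots> = 1 / ?N * ?N" using that p_gt_1[of k] by (intro pnorm_cmult) (auto simp: pnorm_nonneg)
    finally show ?thesis using pnorm_s_map_pos[OF assms that] by simp
  qed
  moreover have "0 < H x k j" if "k \<in> L" "j < d k" for k j
    using that assms s_map_pos pnorm_s_map_pos by (simp add: H_eq)
  ultimately show ?thesis
    by (auto simp: sphere_Spp_def sphere_S_def space_R_def hgpm_step_def)
qed

lemma Spp_positive: "x \<in> sphere_Spp m d p i \<Longrightarrow> positive x"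
  by (auto simp: sphere_Spp_def positive_def)

lemma Spp_sum:
  assumes "x \<in> sphere_Spp m d p i" "k \<in> L"
  shows "(\<Sum>j<d k. x k j powr p k) = 1"
proof -
  have "pnorm (p k) (d k) (x k) powr p k = 1"
    using assms by (auto simp: sphere_Spp_def sphere_S_def)
  then have "(\<Sum>j<d k. \<bar>x k j\<bar> powr p k) = 1" using p_gt_1[OF assms(2)] by (simp add: pnorm_powr)
  moreover have "(\<Sum>j<d k. \<bar>x k j\<bar> powr p k) = (\<Sum>j<d k. x k j powr p k)"
    using assms by (auto simp: sphere_Spp_def less_imp_le intro!: sum.cong)
  ultimately show ?thesis by simp
qed

lemma iterates_positive: "positive x \<Longrightarrow> positive (hgpm_x f m d p i x n)"
  by (induction n) (auto intro: H_Spp Spp_positive)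

lemma iterates_Spp: "x \<in> sphere_Spp m d p i \<Longrightarrow> hgpm_x f m d p i x n \<in> sphere_Spp m d p i"
  by (induction n) (auto intro: H_Spp Spp_positive)

section \<open>Logarithmic derivatives of the iteration\<close>

text \<open>\<open>W x\<close> is an unnormalised probability distribution on multi-indices, \<open>marg x k\<close> its \<open>k\<close>-th
  marginal and \<open>cnd x k\<close> the conditional expectation given the \<open>k\<close>-th index. All derivatives below
  are conditional expectations for this distribution.\<close>

definition W :: "point \<Rightarrow> (nat \<Rightarrow> nat) \<Rightarrow> real" where
  "W x J = f J * (\<Prod>l<m. ext x l (J l))"

definition marg :: "point \<Rightarrow> nat \<Rightarrow> nat \<Rightarrow> real" where
  "marg x k j = (\<Sum>J\<in>{J\<in>I. J k = j}. W x J)"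

definition cnd :: "point \<Rightarrow> nat \<Rightarrow> ((nat \<Rightarrow> nat) \<Rightarrow> real) \<Rightarrow> nat \<Rightarrow> real" where
  "cnd x k \<phi> j = (\<Sum>J\<in>{J\<in>I. J k = j}. W x J * \<phi> J) / marg x k j"

definition \<Lambda> :: "point \<Rightarrow> real" where
  "\<Lambda> x = (\<Sum>J\<in>I. W x J)"

definition \<mu> :: "point \<Rightarrow> point \<Rightarrow> nat \<Rightarrow> nat \<Rightarrow> real" where
  "\<mu> x w l a = cnd x i (\<lambda>J. w l (J l)) a"

text \<open>The logarithmic derivative, in direction \<open>w\<close>, of the term with index
  \<open>J\<close> in \<open>gr k (ext x)\<close>. The second sum is the contribution of mode
  \<open>i\<close>, which is itself a power of a gradient.\<close>

definition Y :: "point \<Rightarrow> point \<Rightarrow> nat \<Rightarrow> (nat \<Rightarrow> nat) \<Rightarrow> real" where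
  "Y x w k J = (\<Sum>l\<in>L. if l = k then 0 else w l (J l)) + (q - 1) * (\<Sum>l\<in>L. \<mu> x w l (J i))"

lemma W_nonneg: "positive x \<Longrightarrow> J \<in> I \<Longrightarrow> 0 \<le> W x J"
  unfolding W_def using fnonneg ext_pos multi_idx_less
  by (intro mult_nonneg_nonneg prod_nonneg) (auto simp: less_imp_le)

lemma W_pos: "positive x \<Longrightarrow> J \<in> I \<Longrightarrow> 0 < f J \<Longrightarrow> 0 < W x J"
  unfolding W_def using ext_pos multi_idx_less
  by (intro mult_pos_pos prod_pos) auto

lemma sum_W_group:
  assumes "k < m" "j < d k"
  shows "(\<Sum>J\<in>{J\<in>I. J k = j}. W x J * \<phi> J) =
         ext x k j * (\<Sum>J\<in>{J\<in>I. J k = j}. f J * (\<Prod>l\<in>{..<m}-{k}. ext x l (J l)) * \<phi> J)"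
  unfolding sum_distrib_left
proof (intro sum.cong refl)
  fix J assume J: "J \<in> {J\<in>I. J k = j}"
  have "(\<Prod>l<m. ext x l (J l)) = ext x k (J k) * (\<Prod>l\<in>{..<m}-{k}. ext x l (J l))"
    using assms by (intro prod.remove) auto
  then show "W x J * \<phi> J = ext x k j * (f J * (\<Prod>l\<in>{..<m}-{k}. ext x l (J l)) * \<phi> J)"
    using J by (simp add: W_def mult_ac)
qed

lemma marg_eq: "k < m \<Longrightarrow> j < d k \<Longrightarrow> marg x k j = ext x k j * gr k (ext x) j"
  using sum_W_group[of k j x "\<lambda>_. 1"] by (simp add: marg_def grad_def)

lemma marg_pos: "positive x \<Longrightarrow> k < m \<Longrightarrow> j < d k \<Longrightarrow> 0 < marg x k j"
  by (simp add: marg_eq ext_pos grad_ext_pos)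

lemma marg_i: "positive x \<Longrightarrow> a < d i \<Longrightarrow> marg x i a = gr i x a powr q"
proof -
  assume *: "positive x" "a < d i"
  have "gr i x a powr (q - 1) * gr i x a = gr i x a powr (q - 1) * gr i x a powr 1"
    using gi_pos[OF *] by simp
  also have "\<dots> = gr i x a powr q" unfolding powr_add[symmetric] by simp
  finally show ?thesis using * im by (simp add: marg_eq grad_i_ext ext_simps)
qed

lemma sum_marg: "k < m \<Longrightarrow> (\<Sum>j<d k. marg x k j) = \<Lambda> x"
  unfolding \<Lambda>_def by (subst sum_multi_idx_group) (auto simp: marg_def)

lemma \<Lambda>_eq: "positive x \<Longrightarrow> \<Lambda> x = (\<Sum>a<d i. gr i x a powr q)"
  using sum_marg[OF im, of x] by (simp add: marg_i)

lemma \<Lambda>_pos: "positive x \<Longrightarrow> 0 < \<Lambda> x"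
  unfolding sum_marg[OF im, symmetric] using marg_pos im d_pos[OF im] by (intro sum_pos) auto

lemma marg_cnd: "positive x \<Longrightarrow> k < m \<Longrightarrow> j < d k \<Longrightarrow>
    marg x k j * cnd x k \<phi> j = (\<Sum>J\<in>{J\<in>I. J k = j}. W x J * \<phi> J)"
  using marg_pos[of x k j] by (simp add: cnd_def)

lemma cnd_sum: "cnd x k (\<lambda>J. \<Sum>l\<in>S. \<phi> l J) j = (\<Sum>l\<in>S. cnd x k (\<phi> l) j)"
  unfolding cnd_def sum_divide_distrib[symmetric]
  by (subst sum.swap) (simp add: sum_distrib_left)

text \<open>An entry of the gradient is a sum of products, so its logarithmic derivative is a mean
  of sums \<open>v l (J l)\<close>. The absent factor \<open>ext x k j\<close> is common to all
  terms with \<open>J k = j\<close>, hence weighting by \<open>W x\<close> gives the same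
  mean.\<close>

lemma log_deriv_grad:
  assumes e: "e \<longlonglongrightarrow> 0" "\<And>n. e n \<noteq> 0" and x: "positive x" and k: "k < m" "j < d k"
    and X: "\<And>l j. l < m \<Longrightarrow> l \<noteq> k \<Longrightarrow> j < d l \<Longrightarrow> log_deriv e (\<lambda>n. X n l j) (ext x l j) (v l j)"
  shows "log_deriv e (\<lambda>n. gr k (X n) j) (gr k (ext x) j)
           (cnd x k (\<lambda>J. \<Sum>l\<in>{..<m}-{k}. v l (J l)) j)"
proof -
  let ?S = "{J\<in>I. J k = j}"
  let ?A = "\<lambda>J. \<Prod>l\<in>{..<m}-{k}. ext x l (J l)"
  let ?V = "\<lambda>J. \<Sum>l\<in>{..<m}-{k}. v l (J l)"
  obtain J0 where J0: "J0 \<in> I" "J0 k = j" "0 < f J0"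
    using positive_entry_through_vertex k by blast
  have "log_deriv e (\<lambda>n. \<Sum>J\<in>?S. f J * (\<Prod>l\<in>{..<m}-{k}. X n l (J l))) (\<Sum>J\<in>?S. f J * ?A J)
     ((\<Sum>J\<in>?S. f J * ?A J * ?V J) / (\<Sum>J\<in>?S. f J * ?A J))"
  proof (rule log_deriv_weighted_sum[OF e, where t = J0])
    fix J assume "J \<in> ?S"
    then show "log_deriv e (\<lambda>n. \<Prod>l\<in>{..<m}-{k}. X n l (J l)) (?A J) (?V J)"
      by (intro log_deriv_prod X) (auto simp: multi_idx_less)
  qed (use J0 finite_I fnonneg in auto)
  then show ?thesis
  proof (rule log_deriv_cong)
    have "0 < ext x k j" using x k by (rule ext_pos)
    then show "(\<Sum>J\<in>?S. f J * ?A J * ?V J) / (\<Sum>J\<in>?S. f J * ?A J) = cnd x k ?V j"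
      using k by (simp add: cnd_def marg_eq sum_W_group) (simp add: grad_def)
  qed (simp_all add: grad_def)
qed

section \<open>Derivatives along a sequence \<open>X n\<close> with logarithmic direction
  \<open>w\<close> at \<open>x\<close>\<close>

context
  fixes e :: "nat \<Rightarrow> real" and x :: point and X :: "nat \<Rightarrow> point" and w :: point
  assumes e: "e \<longlonglongrightarrow> 0" "\<And>n. e n \<noteq> 0" and x: "positive x"
    and X: "\<And>l j. l \<in> L \<Longrightarrow> j < d l \<Longrightarrow> log_deriv e (\<lambda>n. X n l j) (x l j) (w l j)"
begin

lemma approx_positive: "positive (X n)"
  unfolding positive_def using log_deriv_pos(2)[OF X] by blast

lemma log_deriv_grad_i:
  assumes "a < d i"
  shows "log_deriv e (\<lambda>n. gr i (X n) a) (gr i x a) (\<Sum>l\<in>L. \<mu> x w l a)"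
  using log_deriv_grad[OF e x im assms, of X w] X
  by (simp add: ext_simps grad_i_ext cnd_sum \<mu>_def)

lemma log_deriv_ext:
  assumes "l < m" "j < d l"
  shows "log_deriv e (\<lambda>n. ext (X n) l j) (ext x l j)
           (if l = i then (q - 1) * (\<Sum>l\<in>L. \<mu> x w l j) else w l j)"
proof (cases "l = i")
  case True
  then show ?thesis using log_deriv_powr[OF log_deriv_grad_i[of j], of "q - 1"] assms
    by (simp add: ext_simps approx_positive x)
next
  case False
  then show ?thesis using X assms by (simp add: ext_simps)
qed

lemma log_deriv_s_map:
  assumes k: "k \<in> L" and j: "j < d k"
  shows "log_deriv e (\<lambda>n. s_map f m d p i k (X n) j) (s_map f m d p i k x j)
           (1 / (p k - 1) * cnd x k (Y x w k) j)"
proof -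
  let ?v = "\<lambda>l j. if l = i then (q - 1) * (\<Sum>l\<in>L. \<mu> x w l j) else w l j"
  have "(\<Sum>l\<in>{..<m}-{k}. ?v l (J l)) = Y x w k J" for J
  proof -
    have "(\<Sum>l\<in>{..<m}-{k}. ?v l (J l)) = ?v i (J i) + (\<Sum>l\<in>{..<m}-{k}-{i}. ?v l (J l))"
      using k im by (intro sum.remove) auto
    also have "(\<Sum>l\<in>{..<m}-{k}-{i}. ?v l (J l)) = (\<Sum>l\<in>L-{k}. w l (J l))"
      by (intro sum.cong) auto
    also have "(\<Sum>l\<in>L-{k}. w l (J l)) = (\<Sum>l\<in>L. if l = k then 0 else w l (J l))"
      by (intro sum.mono_neutral_cong_left) auto
    finally show ?thesis by (simp add: Y_def)
  qed
  then have "log_deriv e (\<lambda>n. gr k (ext (X n)) j) (gr k (ext x) j) (cnd x k (Y x w k) j)"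
    using log_deriv_grad[OF e x, of k j "\<lambda>n. ext (X n)" ?v] k j log_deriv_ext by simp
  from log_deriv_powr[OF this, of "1 / (p k - 1)"] show ?thesis
    using k j by (simp add: s_map_eq approx_positive x)
qed

lemma log_deriv_H:
  assumes k: "k \<in> L" and j: "j < d k"
  shows "log_deriv e (\<lambda>n. H (X n) k j) (H x k j)
           (1 / (p k - 1) * cnd x k (Y x w k) j -
            (\<Sum>j<d k. s_map f m d p i k x j powr p k * (1 / (p k - 1) * cnd x k (Y x w k) j)) /
            (\<Sum>j<d k. s_map f m d p i k x j powr p k))"
proof -
  have "log_deriv e (\<lambda>n. pnorm (p k) (d k) (s_map f m d p i k (X n))) (pnorm (p k) (d k) (s_map f m d p i k x))
     ((\<Sum>j<d k. s_map f m d p i k x j powr p k * (1 / (p k - 1) * cnd x k (Y x w k) j)) /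
            (\<Sum>j<d k. s_map f m d p i k x j powr p k))"
    using k p_gt_1[OF k] d_pos[of k] log_deriv_s_map by (intro log_deriv_pnorm[OF e]) auto
  from log_deriv_divide[OF log_deriv_s_map[OF k j] this] show ?thesis
    by (simp only: H_eq[OF k j])
qed

lemma log_deriv_pnorm_mode:
  assumes k: "k \<in> L"
  shows "log_deriv e (\<lambda>n. pnorm (p k) (d k) (X n k)) (pnorm (p k) (d k) (x k))
     ((\<Sum>j<d k. x k j powr p k * w k j) / (\<Sum>j<d k. x k j powr p k))"
  using k p_gt_1[OF k] d_pos[of k] X by (intro log_deriv_pnorm[OF e]) auto

text \<open>By \<open>marg_i\<close> the weights \<open>gr i x a powr q\<close> form the
  \<open>i\<close>-th marginal, so averaging the conditional means \<open>\<mu>\<close> against them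
  gives an expectation over all multi-indices. Each norm in the denominator subtracts one
  mean.\<close>

lemma log_deriv_Qfun:
  "log_deriv e (\<lambda>n. Qfun f m d p i (X n)) (Qfun f m d p i x)
     ((\<Sum>J\<in>I. W x J * (\<Sum>l\<in>L. w l (J l))) / \<Lambda> x -
      (\<Sum>k\<in>L. (\<Sum>j<d k. x k j powr p k * w k j) / (\<Sum>j<d k. x k j powr p k)))"
proof -
  have "log_deriv e (\<lambda>n. pnorm q (d i) (gr i (X n))) (pnorm q (d i) (gr i x))
     ((\<Sum>a<d i. gr i x a powr q * (\<Sum>l\<in>L. \<mu> x w l a)) / (\<Sum>a<d i. gr i x a powr q))"
    using q_gt_1 d_pos[OF im] log_deriv_grad_i by (intro log_deriv_pnorm[OF e]) auto
  moreover have "(\<Sum>a<d i. gr i x a powr q * (\<Sum>l\<in>L. \<mu> x w l a)) = (\<Sum>J\<in>I. W x J * (\<Sum>l\<in>L. w l (J l)))"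
  proof -
    have "gr i x a powr q * (\<Sum>l\<in>L. \<mu> x w l a) = (\<Sum>J\<in>{J\<in>I. J i = a}. W x J * (\<Sum>l\<in>L. w l (J l)))"
      if "a < d i" for a
      using marg_cnd[OF x im that, of "\<lambda>J. \<Sum>l\<in>L. w l (J l)"] that
      by (simp add: marg_i x cnd_sum \<mu>_def)
    then show ?thesis by (subst sum_multi_idx_group[OF im]) simp
  qed
  ultimately have "log_deriv e (\<lambda>n. pnorm q (d i) (gr i (X n))) (pnorm q (d i) (gr i x))
     ((\<Sum>J\<in>I. W x J * (\<Sum>l\<in>L. w l (J l))) / \<Lambda> x)" by (simp add: \<Lambda>_eq x)
  from log_deriv_divide[OF this log_deriv_prod[OF _ log_deriv_pnorm_mode, of L "\<lambda>k. k"]] show ?thesis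
    by (simp add: Qfun_def q_def)
qed

end

end

section \<open>Marginals at the critical point, and the fixed-point property\<close>

locale critical_point = tensor_setup +
  fixes xs :: point
  assumes xs_Spp: "xs \<in> sphere_Spp m d p i"
    and xs_crit: "critical_Q f m d p i xs"
begin

lemma xs_positive: "positive xs" by (rule Spp_positive[OF xs_Spp])

lemma xs_pos: "k \<in> L \<Longrightarrow> j < d k \<Longrightarrow> 0 < xs k j"
  using xs_positive by (simp add: positive_def)

text \<open>Moving only the coordinate \<open>xs k j\<close> changes the logarithm of
  \<open>Qfun\<close> at rate \<open>marg xs k j / \<Lambda> xs - xs k j powr p k\<close>, by
  \<open>log_deriv_Qfun\<close> and the normalisation of \<open>xs\<close>. Criticality makes this
  rate 0.\<close>

lemma marg_xs:
  assumes k: "k \<in> L" and j: "j < d k"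
  shows "marg xs k j = \<Lambda> xs * xs k j powr p k"
proof -
  define e where "e = (\<lambda>n. 1 / real (Suc n))"
  define w where "w = (\<lambda>l b. if l = k \<and> b = j then 1 else 0 :: real)"
  define X where "X = (\<lambda>t. xs(k := (xs k)(j := xs k j + t)))"
  \<comment> \<open>With this step the relative increment of the moved coordinate is exactly
    \<open>e n\<close>, so the logarithmic direction is the indicator \<open>w\<close>.\<close>
  define t where "t = (\<lambda>n. xs k j * e n)"
  have e: "e \<longlonglongrightarrow> 0" "\<And>n. e n \<noteq> 0" and e_pos: "\<And>n. 0 < e n"
    using LIMSEQ_inverse_real_of_nat by (simp_all add: e_def inverse_eq_divide)
  have X_eq: "X s l b = xs l b + (if l = k \<and> b = j then s else 0)" for s l b
    by (auto simp: X_def)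
  have X0: "X 0 = xs" by (auto simp: X_def)
  have xk: "0 < xs k j" using k j by (rule xs_pos)
  have ld: "log_deriv e (\<lambda>n. X (t n) l b) (xs l b) (w l b)" if lb: "l \<in> L" "b < d l" for l b
  proof -
    have p1: "0 < xs l b" using lb by (rule xs_pos)
    have p2: "0 < X (t n) l b" for n using p1 xk e_pos[of n]
      by (simp add: X_eq t_def add_pos_pos)
    have "(X (t n) l b / xs l b - 1) / e n = w l b" for n
      using p1 e_pos[of n] by (simp add: X_eq t_def w_def field_simps)
    then show ?thesis by (subst log_deriv_iff_relative[OF e p1 p2]) simp
  qed
  note Q = log_deriv_Qfun[OF e xs_positive ld]
  have "((\<lambda>s. Qfun f m d p i (X s)) has_real_derivative 0) (at 0)"
    using xs_crit k j unfolding critical_Q_def X_def by simp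
  moreover have "(\<lambda>n. (t n - 0) / e n) \<longlonglongrightarrow> xs k j" using e(2) by (simp add: t_def)
  ultimately have "(\<lambda>n. (Qfun f m d p i (X (t n)) - Qfun f m d p i xs) / e n) \<longlonglongrightarrow> 0"
    using difference_quotient_chain[OF e, of t 0 _ "\<lambda>s. Qfun f m d p i (X s)" 0] X0 by fastforce
  then have "(\<lambda>n. (Qfun f m d p i (X (t n)) - Qfun f m d p i xs) / e n / Qfun f m d p i xs) \<longlonglongrightarrow> 0 / Qfun f m d p i xs"
    using log_deriv_pos(1)[OF Q] by (intro tendsto_divide) auto
  then have "(\<lambda>n. (Qfun f m d p i (X (t n)) / Qfun f m d p i xs - 1) / e n) \<longlonglongrightarrow> 0"
    using log_deriv_pos(1)[OF Q] by (simp add: field_simps)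
  then have "log_deriv e (\<lambda>n. Qfun f m d p i (X (t n))) (Qfun f m d p i xs) 0"
    using log_deriv_iff_relative[OF e log_deriv_pos[OF Q]] by simp
  then have 0: "(\<Sum>J\<in>I. W xs J * (\<Sum>l\<in>L. w l (J l))) / \<Lambda> xs =
      (\<Sum>k\<in>L. (\<Sum>j<d k. xs k j powr p k * w k j) / (\<Sum>j<d k. xs k j powr p k))"
    using Q LIMSEQ_unique unfolding log_deriv_def by fastforce
  have "(\<Sum>l\<in>L. w l (J l)) = (if J k = j then 1 else 0)" for J
  proof -
    have "(\<Sum>l\<in>L. w l (J l)) = (\<Sum>l\<in>L. if l = k then if J k = j then 1 else 0 else 0)"
      by (intro sum.cong) (auto simp: w_def)
    then show ?thesis using k by (simp add: sum.delta)
  qed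
  then have lhs: "(\<Sum>J\<in>I. W xs J * (\<Sum>l\<in>L. w l (J l))) = marg xs k j"
    unfolding marg_def using finite_I by (intro sum.mono_neutral_cong_right) auto
  have "(\<Sum>l\<in>L. (\<Sum>b<d l. xs l b powr p l * w l b) / (\<Sum>b<d l. xs l b powr p l)) = (\<Sum>l\<in>L. \<Sum>b<d l. xs l b powr p l * w l b)"
    by (intro sum.cong refl) (simp add: Spp_sum[OF xs_Spp])
  also have "\<dots> = (\<Sum>l\<in>L. if l = k then xs k j powr p k else 0)"
  proof (intro sum.cong refl)
    fix l assume "l \<in> L"
    have "(\<Sum>b<d l. xs l b powr p l * w l b) = (\<Sum>b<d l. if b = j then if l = k then xs k j powr p k else 0 else 0)"
      by (intro sum.cong) (auto simp: w_def)
    then show "(\<Sum>b<d l. xs l b powr p l * w l b) = (if l = k then xs k j powr p k else 0)"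
      using j by simp
  qed
  also have "\<dots> = xs k j powr p k" using k by simp
  finally show ?thesis using 0 lhs \<Lambda>_pos[OF xs_positive] by (simp add: field_simps)
qed

text \<open>Dividing \<open>marg_xs\<close> by \<open>xs k j\<close> gives the gradient entry as a
  multiple of \<open>xs k j powr (p k - 1)\<close>; the root in \<open>s_map\<close> undoes the
  power.\<close>

lemma s_map_xs:
  assumes "k \<in> L" "j < d k"
  shows "s_map f m d p i k xs j = \<Lambda> xs powr (1 / (p k - 1)) * xs k j"
proof -
  have pos: "0 < xs k j" "1 < p k" using assms xs_pos p_gt_1 by auto
  have "xs k j powr p k = xs k j * xs k j powr (p k - 1)"
    using pos powr_add[of "xs k j" 1 "p k - 1"] by simp
  then have "gr k (ext xs) j = \<Lambda> xs * xs k j powr (p k - 1)"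
    using marg_xs[OF assms] marg_eq[of k j xs] assms pos by (simp add: ext_simps)
  then show ?thesis using assms pos
    by (simp add: s_map_eq xs_positive powr_mult powr_powr \<Lambda>_pos[OF xs_positive, THEN less_imp_le])
qed

lemma pnorm_xs: "k \<in> L \<Longrightarrow> pnorm (p k) (d k) (xs k) = 1"
  using xs_Spp by (auto simp: sphere_Spp_def sphere_S_def)

lemma H_xs: "H xs = xs"
proof (intro ext)
  fix k j
  show "H xs k j = xs k j"
  proof (cases "k \<in> L \<and> j < d k")
    case True
    let ?c = "\<Lambda> xs powr (1 / (p k - 1))"
    have "pnorm (p k) (d k) (s_map f m d p i k xs) = pnorm (p k) (d k) (\<lambda>j. ?c * xs k j)"
      using True by (intro pnorm_cong) (simp add: s_map_xs)
    also have "\<dots> = ?c" using True p_gt_1[of k] pnorm_xs by (subst pnorm_cmult) auto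
    finally show ?thesis using True \<Lambda>_pos[OF xs_positive] by (simp add: H_eq s_map_xs)
  next
    case False
    then show ?thesis using xs_Spp
      by (auto simp: hgpm_step_def sphere_Spp_def sphere_S_def space_R_def)
  qed
qed

section \<open>The linearised iteration is a strict contraction\<close>

definition E :: "((nat \<Rightarrow> nat) \<Rightarrow> real) \<Rightarrow> real" where
  "E \<phi> = (\<Sum>J\<in>I. W xs J * \<phi> J)"

text \<open>Up to \<open>\<Lambda> xs\<close>, the power of \<open>xs k j\<close> is the
  \<open>k\<close>-th marginal, so \<open>nrm2\<close> is a sum of second moments. The factor
  \<open>p k - 1\<close> is matched to the division by \<open>p k - 1\<close> in
  \<open>M\<close>.\<close>

definition \<omega> :: "nat \<Rightarrow> nat \<Rightarrow> real" where
  "\<omega> k j = (p k - 1) * xs k j powr p k"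

definition nrm2 :: "point \<Rightarrow> real" where
  "nrm2 w = (\<Sum>k\<in>L. \<Sum>j<d k. \<omega> k j * (w k j)\<^sup>2)"

text \<open>The linearisation of \<open>s_map\<close> at \<open>xs\<close> in logarithmic
  coordinates. Normalising to the spheres then subtracts \<open>avg\<close> in each mode.\<close>

definition M :: "point \<Rightarrow> point" where
  "M w k j = cnd xs k (Y xs w k) j / (p k - 1)"

definition avg :: "nat \<Rightarrow> (nat \<Rightarrow> real) \<Rightarrow> real" where
  "avg k v = (\<Sum>j<d k. xs k j powr p k * v j)"

lemma \<omega>_pos: "k \<in> L \<Longrightarrow> j < d k \<Longrightarrow> 0 < \<omega> k j"
  using xs_pos[of k j] p_gt_1[of k] by (simp add: \<omega>_def)

lemma E_add: "E (\<lambda>J. \<phi> J + \<psi> J) = E \<phi> + E \<psi>"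
  by (simp add: E_def distrib_left sum.distrib)

lemma E_diff: "E (\<lambda>J. \<phi> J - \<psi> J) = E \<phi> - E \<psi>"
  by (simp add: E_def right_diff_distrib sum_subtractf)

lemma E_cmult: "E (\<lambda>J. a * \<phi> J) = a * E \<phi>"
  by (simp add: E_def sum_distrib_left mult_ac)

lemma E_sum: "E (\<lambda>J. \<Sum>l\<in>S. \<phi> l J) = (\<Sum>l\<in>S. E (\<phi> l))"
  unfolding E_def by (subst sum.swap) (simp add: sum_distrib_left)

lemma E_nonneg: "(\<And>J. 0 \<le> \<phi> J) \<Longrightarrow> 0 \<le> E \<phi>"
  unfolding E_def by (intro sum_nonneg mult_nonneg_nonneg W_nonneg xs_positive)

lemma E_eq_0_imp:
  assumes "E \<phi> = 0" "\<And>J. 0 \<le> \<phi> J" "J \<in> I" "0 < f J"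
  shows "\<phi> J = 0"
proof -
  have "\<forall>J\<in>I. W xs J * \<phi> J = 0"
    using assms(1,2) finite_I W_nonneg[OF xs_positive]
    unfolding E_def by (subst sum_nonneg_eq_0_iff[symmetric]) auto
  then show ?thesis using assms(3,4) W_pos[OF xs_positive, of J] by auto
qed

lemma E_mode:
  assumes "k < m"
  shows "E (\<lambda>J. \<phi> J * g (J k)) = (\<Sum>j<d k. marg xs k j * cnd xs k \<phi> j * g j)"
  unfolding E_def
  by (subst sum_multi_idx_group[OF assms])
     (auto simp: marg_cnd xs_positive assms sum_distrib_left mult_ac intro!: sum.cong)

lemma E_fun:
  assumes "k < m"
  shows "E (\<lambda>J. g (J k)) = (\<Sum>j<d k. marg xs k j * g j)"
  unfolding E_def marg_def sum_distrib_right by (subst sum_multi_idx_group[OF assms]) auto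

lemma E_fun_L: "k \<in> L \<Longrightarrow> E (\<lambda>J. g (J k)) = \<Lambda> xs * avg k g"
  by (simp add: E_fun marg_xs avg_def sum_distrib_left mult_ac)

text \<open>Pythagoras: conditional expectation is the orthogonal projection onto functions of the
  \<open>k\<close>-th index.\<close>

lemma E_cnd_square:
  assumes "k < m"
  shows "E (\<lambda>J. (cnd xs k \<phi> (J k))\<^sup>2) = E (\<lambda>J. (\<phi> J)\<^sup>2) - E (\<lambda>J. (\<phi> J - cnd xs k \<phi> (J k))\<^sup>2)"
proof -
  have "E (\<lambda>J. \<phi> J * cnd xs k \<phi> (J k)) = E (\<lambda>J. (cnd xs k \<phi> (J k))\<^sup>2)"
    unfolding E_mode[OF assms] E_fun[OF assms, of "\<lambda>j. (cnd xs k \<phi> j)\<^sup>2"]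
    by (simp add: power2_eq_square mult_ac)
  moreover have "E (\<lambda>J. (\<phi> J - cnd xs k \<phi> (J k))\<^sup>2) =
      E (\<lambda>J. (\<phi> J)\<^sup>2) + E (\<lambda>J. (cnd xs k \<phi> (J k))\<^sup>2) - 2 * E (\<lambda>J. \<phi> J * cnd xs k \<phi> (J k))"
    unfolding power2_diff E_diff E_add E_cmult[symmetric] by (simp add: mult_ac)
  ultimately show ?thesis by simp
qed

lemma \<Lambda>_nrm2: "\<Lambda> xs * nrm2 w = (\<Sum>k\<in>L. (p k - 1) * E (\<lambda>J. (w k (J k))\<^sup>2))"
proof -
  have "(p k - 1) * E (\<lambda>J. (w k (J k))\<^sup>2) = \<Lambda> xs * (\<Sum>j<d k. \<omega> k j * (w k j)\<^sup>2)" if "k \<in> L" for k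
    using E_fun_L[OF that, of "\<lambda>j. (w k j)\<^sup>2"]
    by (simp add: avg_def \<omega>_def sum_distrib_left mult_ac)
  then show ?thesis by (simp add: nrm2_def sum_distrib_left)
qed

text \<open>In each mode the weights \<open>xs k j powr p k\<close> sum to 1, and a variance is at
  most the second moment.\<close>

lemma nrm2_center_le:
  "nrm2 (\<lambda>k j. w k j - avg k (w k)) \<le> nrm2 w"
  unfolding nrm2_def
proof (rule sum_mono)
  fix k assume k: "k \<in> L"
  let ?a = "avg k (w k)"
  have 1: "(\<Sum>j<d k. xs k j powr p k) = 1" using Spp_sum[OF xs_Spp k] .
  have "(\<Sum>j<d k. xs k j powr p k * (w k j - ?a)\<^sup>2) =
     (\<Sum>j<d k. xs k j powr p k * (w k j)\<^sup>2 + ?a\<^sup>2 * xs k j powr p k - 2 * ?a * (xs k j powr p k * w k j))"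
    by (intro sum.cong) (auto simp: power2_eq_square algebra_simps)
  also have "\<dots> = (\<Sum>j<d k. xs k j powr p k * (w k j)\<^sup>2) + ?a\<^sup>2 * 1 - 2 * ?a * ?a"
    by (simp add: sum.distrib sum_subtractf sum_distrib_left[symmetric] 1 avg_def)
  also have "\<dots> \<le> (\<Sum>j<d k. xs k j powr p k * (w k j)\<^sup>2)" by (simp add: power2_eq_square)
  finally have "(p k - 1) * (\<Sum>j<d k. xs k j powr p k * (w k j - ?a)\<^sup>2) \<le> (p k - 1) * (\<Sum>j<d k. xs k j powr p k * (w k j)\<^sup>2)"
    using p_gt_1[OF k] by (intro mult_left_mono) auto
  then show "(\<Sum>j<d k. \<omega> k j * (w k j - ?a)\<^sup>2) \<le> (\<Sum>j<d k. \<omega> k j * (w k j)\<^sup>2)"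
    by (simp add: \<omega>_def sum_distrib_left mult_ac)
qed

text \<open>\<open>Y xs w k J / c\<close> is a weighted mean of the numbers \<open>w l (J l)\<close> and \<open>\<mu> xs w l (J i)\<close>, and
  \<open>V w k J\<close> is the corresponding (unnormalised) variance.\<close>

definition V :: "point \<Rightarrow> nat \<Rightarrow> (nat \<Rightarrow> nat) \<Rightarrow> real" where
  "V w k J = (\<Sum>l\<in>L. if l = k then 0 else (w l (J l) - Y xs w k J / c)\<^sup>2) +
     (q - 1) * (\<Sum>l\<in>L. (\<mu> xs w l (J i) - Y xs w k J / c)\<^sup>2)"

lemma V_nonneg: "0 \<le> V w k J"
  unfolding V_def using q_gt_1 by (intro add_nonneg_nonneg mult_nonneg_nonneg sum_nonneg) auto

lemma card_L: "real (card L) = real m - 1"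
  using im by simp

lemma sum_L_except:
  assumes "k \<in> L"
  shows "(\<Sum>l\<in>L. if l = k then 0 else g l) = (\<Sum>l\<in>L. g l) - (g k :: real)"
proof -
  have "(\<Sum>l\<in>L. if l = k then 0 else g l) = (\<Sum>l\<in>L. g l - (if l = k then g k else 0))"
    by (intro sum.cong) auto
  also have "\<dots> = (\<Sum>l\<in>L. g l) - (\<Sum>l\<in>L. if l = k then g k else 0)" by (rule sum_subtractf)
  finally show ?thesis using assms by simp
qed

text \<open>The identity between variance, mean square and squared mean, for weights of total
  \<open>(m - 2) + (q - 1) * (m - 1) = c\<close>.\<close>

lemma Y_square:
  assumes k: "k \<in> L"
  shows "(Y xs w k J)\<^sup>2 / c = (\<Sum>l\<in>L. (w l (J l))\<^sup>2) - (w k (J k))\<^sup>2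
           + (q - 1) * (\<Sum>l\<in>L. (\<mu> xs w l (J i))\<^sup>2) - V w k J"
proof -
  let ?y = "Y xs w k J / c" and ?a = "\<lambda>l. w l (J l)" and ?b = "\<lambda>l. \<mu> xs w l (J i)"
  have sq: "(\<Sum>l\<in>L. (g l - y)\<^sup>2) = (\<Sum>l\<in>L. (g l)\<^sup>2) + (real m - 1) * y\<^sup>2 - 2 * y * (\<Sum>l\<in>L. g l)"
    for g y
    by (simp only: power2_diff sum.distrib sum_subtractf sum_constant card_L)
       (simp add: sum_distrib_left mult_ac)
  have V: "V w k J = (\<Sum>l\<in>L. (?a l)\<^sup>2) + (real m - 1) * ?y\<^sup>2 - 2 * ?y * (\<Sum>l\<in>L. ?a l) - (?a k - ?y)\<^sup>2
     + (q - 1) * ((\<Sum>l\<in>L. (?b l)\<^sup>2) + (real m - 1) * ?y\<^sup>2 - 2 * ?y * (\<Sum>l\<in>L. ?b l))"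
    unfolding V_def sum_L_except[OF k] sq ..
  have Y: "Y xs w k J = (\<Sum>l\<in>L. ?a l) - ?a k + (q - 1) * (\<Sum>l\<in>L. ?b l)"
    by (simp only: Y_def sum_L_except[OF k])
  have "V w k J = (\<Sum>l\<in>L. (?a l)\<^sup>2) - (?a k)\<^sup>2 + (q - 1) * (\<Sum>l\<in>L. (?b l)\<^sup>2) + c * ?y\<^sup>2
     - 2 * ?y * ((\<Sum>l\<in>L. ?a l) - ?a k + (q - 1) * (\<Sum>l\<in>L. ?b l))"
    unfolding V by (simp only: c_def power2_diff) algebra
  also have "\<dots> = (\<Sum>l\<in>L. (?a l)\<^sup>2) - (?a k)\<^sup>2 + (q - 1) * (\<Sum>l\<in>L. (?b l)\<^sup>2) - (Y xs w k J)\<^sup>2 / c"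
    unfolding Y[symmetric] using c_pos by (simp add: power2_eq_square)
  finally show ?thesis by simp
qed

text \<open>The contraction estimate with two of its losses kept: the one from projecting onto mode
  \<open>i\<close> and the variance of the terms averaged in \<open>Y\<close>. Their vanishing is
  what the equality case exploits.\<close>

lemma nrm2_deficit:
  "(real m - 1) * (q - 1) * (\<Sum>l\<in>L. E (\<lambda>J. (w l (J l) - \<mu> xs w l (J i))\<^sup>2)) + (\<Sum>k\<in>L. E (V w k))
     \<le> \<Lambda> xs * nrm2 w - \<Lambda> xs * nrm2 (M w)"
proof -
  let ?A = "\<lambda>l. E (\<lambda>J. (w l (J l))\<^sup>2)" and ?D = "\<lambda>l. E (\<lambda>J. (w l (J l) - \<mu> xs w l (J i))\<^sup>2)"
  have mu: "E (\<lambda>J. (\<mu> xs w l (J i))\<^sup>2) = ?A l - ?D l" for l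
    unfolding \<mu>_def by (rule E_cnd_square[OF im])
  have "(p k - 1) * E (\<lambda>J. (M w k (J k))\<^sup>2) \<le>
      (\<Sum>l\<in>L. ?A l) - ?A k + (q - 1) * (\<Sum>l\<in>L. ?A l - ?D l) - E (V w k)" if k: "k \<in> L" for k
  proof -
    have pk: "0 < p k - 1" "k < m" using p_gt_1[OF k] k by auto
    have "(p k - 1) * E (\<lambda>J. (M w k (J k))\<^sup>2) = E (\<lambda>J. (cnd xs k (Y xs w k) (J k))\<^sup>2) / (p k - 1)"
      unfolding divide_inverse mult.commute[of _ "inverse (p k - 1)"] E_cmult[symmetric]
      using pk by (intro arg_cong[where f = E] ext) (simp add: M_def power2_eq_square inverse_eq_divide)
    also have "\<dots> \<le> E (\<lambda>J. (Y xs w k J)\<^sup>2) / (p k - 1)"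
      unfolding E_cnd_square[OF pk(2)] using pk(1)
      by (intro divide_right_mono) (simp_all add: E_nonneg)
    also have "\<dots> \<le> E (\<lambda>J. (Y xs w k J)\<^sup>2) / c"
      using c_le[OF k] c_pos pk by (intro divide_left_mono E_nonneg) auto
    also have "\<dots> = E (\<lambda>J. (Y xs w k J)\<^sup>2 / c)"
      unfolding divide_inverse mult.commute[of _ "inverse c"] E_cmult ..
    also have "\<dots> = (\<Sum>l\<in>L. ?A l) - ?A k + (q - 1) * (\<Sum>l\<in>L. ?A l - ?D l) - E (V w k)"
      unfolding Y_square[OF k] E_diff E_add E_cmult E_sum mu ..
    finally show ?thesis .
  qed
  then have "\<Lambda> xs * nrm2 (M w) \<le> (\<Sum>k\<in>L. (\<Sum>l\<in>L. ?A l) - ?A k + (q - 1) * (\<Sum>l\<in>L. ?A l - ?D l) - E (V w k))"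
    unfolding \<Lambda>_nrm2 by (rule sum_mono)
  also have "\<dots> = (real m - 1) * (\<Sum>l\<in>L. ?A l) - (\<Sum>l\<in>L. ?A l)
      + (real m - 1) * ((q - 1) * ((\<Sum>l\<in>L. ?A l) - (\<Sum>l\<in>L. ?D l))) - (\<Sum>k\<in>L. E (V w k))"
    by (simp only: sum.distrib sum_subtractf sum_constant card_L)
  \<comment> \<open>Each \<open>?A l\<close> is counted \<open>m - 2\<close> times directly and
    \<open>(m - 1) * (q - 1)\<close> times through \<open>mu\<close>, in total \<open>c\<close>
    times.\<close>
  also have "\<dots> = c * (\<Sum>l\<in>L. ?A l) - (real m - 1) * (q - 1) * (\<Sum>l\<in>L. ?D l) - (\<Sum>k\<in>L. E (V w k))"
    unfolding c_def by algebra
  also have "c * (\<Sum>l\<in>L. ?A l) \<le> \<Lambda> xs * nrm2 w"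
    unfolding \<Lambda>_nrm2 sum_distrib_left
    by (intro sum_mono mult_right_mono c_le E_nonneg) auto
  finally show ?thesis by simp
qed

text \<open>Without contraction both losses of \<open>nrm2_deficit\<close> vanish. Then
  \<open>w\<close>, extended to mode \<open>i\<close> by a conditional mean, is constant along the
  edges of the graph, hence constant, and \<open>avg\<close> equal to 0 forces the constant to be
  0.\<close>

lemma nrm2_strict:
  assumes w0: "\<And>k. k \<in> L \<Longrightarrow> avg k (w k) = 0"
    and le: "nrm2 w \<le> nrm2 (\<lambda>k j. M w k j - avg k (M w k))"
    and k: "k \<in> L" "j < d k"
  shows "w k j = 0"
proof -
  let ?D = "\<lambda>l. E (\<lambda>J. (w l (J l) - \<mu> xs w l (J i))\<^sup>2)"
  have m1: "0 < (real m - 1) * (q - 1)" using m2 q_gt_1 by simp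
  have D0: "0 \<le> ?D l" and V0: "0 \<le> E (V w l)" for l by (auto intro!: E_nonneg V_nonneg)
  have "\<Lambda> xs * nrm2 w \<le> \<Lambda> xs * nrm2 (M w)"
    using le nrm2_center_le[of "M w"] \<Lambda>_pos[OF xs_positive] by (intro mult_left_mono) auto
  with nrm2_deficit[of w] have "(real m - 1) * (q - 1) * (\<Sum>l\<in>L. ?D l) + (\<Sum>k\<in>L. E (V w k)) \<le> 0"
    by linarith
  moreover have "0 \<le> (real m - 1) * (q - 1) * (\<Sum>l\<in>L. ?D l)" "0 \<le> (\<Sum>k\<in>L. E (V w k))"
    by (intro mult_nonneg_nonneg[OF less_imp_le[OF m1]] sum_nonneg D0 V0)+
  ultimately have "(real m - 1) * (q - 1) * (\<Sum>l\<in>L. ?D l) = 0" "(\<Sum>k\<in>L. E (V w k)) = 0" by linarith+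
  then have "(\<Sum>l\<in>L. ?D l) = 0" "(\<Sum>k\<in>L. E (V w k)) = 0" using m1 by auto
  then have D: "?D l = 0" and V: "E (V w l) = 0" if "l \<in> L" for l
    using that D0 V0 by (simp_all add: sum_nonneg_eq_0_iff)
  have w_mu: "w l (J l) = \<mu> xs w l (J i)" if "l \<in> L" "J \<in> I" "0 < f J" for l J
    using E_eq_0_imp[OF D[OF that(1)] _ that(2,3)] by simp
  have mu_mu: "\<mu> xs w l (J i) = \<mu> xs w k (J i)" if "l \<in> L" "J \<in> I" "0 < f J" for l J
  proof -
    have "V w k J = 0" using E_eq_0_imp[OF V[OF k(1)] _ that(2,3)] V_nonneg by simp
    moreover have "0 \<le> (\<Sum>l\<in>L. if l = k then 0 else (w l (J l) - Y xs w k J / c)\<^sup>2)"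
      by (intro sum_nonneg) auto
    moreover have "0 \<le> (q - 1) * (\<Sum>l\<in>L. (\<mu> xs w l (J i) - Y xs w k J / c)\<^sup>2)"
      using q_gt_1 by (intro mult_nonneg_nonneg sum_nonneg) auto
    \<comment> \<open>This sum runs over all of \<open>L\<close>, including \<open>k\<close>, so its
      vanishing equates all the values \<open>\<mu> xs w l (J i)\<close>.\<close>
    ultimately have "(q - 1) * (\<Sum>l\<in>L. (\<mu> xs w l (J i) - Y xs w k J / c)\<^sup>2) = 0"
      unfolding V_def by linarith
    then have "(\<Sum>l\<in>L. (\<mu> xs w l (J i) - Y xs w k J / c)\<^sup>2) = 0" using q_gt_1 by simp
    then have "\<forall>l\<in>L. \<mu> xs w l (J i) = Y xs w k J / c" by (simp add: sum_nonneg_eq_0_iff)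
    then show ?thesis using that(1) k(1) by simp
  qed
  define v where "v = (\<lambda>l j. if l = i then \<mu> xs w k j else w l j)"
  have v: "v l (J l) = \<mu> xs w k (J i)" if "J \<in> I" "0 < f J" "l < m" for J l
    using w_mu[of l J] mu_mu[of l J] that by (auto simp: v_def)
  have const: "w k b = w k j" if "b < d k" for b
    using constant_along_edges_imp_constant[of v k b k j] v k that by (simp add: v_def)
  have "avg k (w k) = (\<Sum>b<d k. xs k b powr p k * w k j)"
    unfolding avg_def using const by (intro sum.cong) auto
  also have "\<dots> = w k j" using Spp_sum[OF xs_Spp k(1)] by (simp add: sum_distrib_right[symmetric])
  finally show ?thesis using w0[OF k(1)] by simp
qed

section \<open>Local linear convergence\<close>

abbreviation S where "S \<equiv> sphere_Spp m d p i"

text \<open>The coordinates \<open>v k j / xs k j\<close> agree to first order with logarithmic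
  coordinates at \<open>xs\<close>, which transfers the estimate for \<open>nrm2\<close> to
  differences of points. The \<open>L2_set\<close> form supplies the triangle inequality.\<close>

definition G :: "point \<Rightarrow> real" where
  "G v = L2_set (\<lambda>(k, j). sqrt (\<omega> k j) * (v k j / xs k j)) (Sigma L (\<lambda>k. {..<d k}))"

lemma G_eq: "G v = sqrt (nrm2 (\<lambda>k j. v k j / xs k j))"
proof -
  have "(sqrt (\<omega> k j) * (v k j / xs k j))\<^sup>2 = \<omega> k j * (v k j / xs k j)\<^sup>2" if "k \<in> L" "j < d k" for k j
    using \<omega>_pos[OF that] by (simp add: power_mult_distrib power_divide)
  then show ?thesis
    unfolding G_def L2_set_def nrm2_def by (subst sum.Sigma) (auto intro!: sum.cong)
qed

lemma nrm2_nonneg: "0 \<le> nrm2 w"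
  unfolding nrm2_def using \<omega>_pos by (intro sum_nonneg mult_nonneg_nonneg) (auto simp: less_imp_le)

lemma nrm2_term_le:
  assumes "k \<in> L" "j < d k"
  shows "\<omega> k j * (w k j)\<^sup>2 \<le> nrm2 w"
proof -
  have "\<omega> k j * (w k j)\<^sup>2 \<le> (\<Sum>j<d k. \<omega> k j * (w k j)\<^sup>2)"
    using assms \<omega>_pos by (intro member_le_sum) (auto simp: less_imp_le)
  also have "\<dots> \<le> nrm2 w" unfolding nrm2_def
    using assms \<omega>_pos by (intro member_le_sum[where f = "\<lambda>k. \<Sum>j<d k. \<omega> k j * (w k j)\<^sup>2"])
      (auto simp: less_imp_le intro!: sum_nonneg)
  finally show ?thesis .
qed

lemma nrm2_scale: "nrm2 (\<lambda>k j. a * w k j) = a\<^sup>2 * nrm2 w"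
  by (simp add: nrm2_def power_mult_distrib sum_distrib_left mult_ac)

lemma G_square: "(G v)\<^sup>2 = nrm2 (\<lambda>k j. v k j / xs k j)"
  by (simp add: G_eq nrm2_nonneg)

lemma G_nonneg: "0 \<le> G v" by (simp add: G_eq nrm2_nonneg)

lemma G_eq_0_imp:
  assumes "G v = 0" "k \<in> L" "j < d k"
  shows "v k j = 0"
proof -
  have "nrm2 (\<lambda>k j. v k j / xs k j) = 0" using assms(1) by (simp add: G_eq)
  with nrm2_term_le[OF assms(2,3), of "\<lambda>k j. v k j / xs k j"]
  have "\<omega> k j * (v k j / xs k j)\<^sup>2 \<le> 0" by simp
  then show ?thesis using \<omega>_pos[OF assms(2,3)] xs_pos[OF assms(2,3)]
    by (simp add: mult_le_0_iff)
qed

lemma is_norm_on_G: "is_norm_on (space_R m d i) G"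
  unfolding is_norm_on_def
proof (intro conjI ballI allI)
  fix x assume x: "x \<in> space_R m d i"
  show "0 \<le> G x" by (rule G_nonneg)
  show "G x = 0 \<longleftrightarrow> x = (\<lambda>k j. 0)"
  proof
    assume "G x = 0"
    then have "x k j = 0" for k j
      using G_eq_0_imp[of x k j] x by (cases "k \<in> L \<and> j < d k") (auto simp: space_R_def)
    then show "x = (\<lambda>k j. 0)" by blast
  qed (simp add: G_eq nrm2_def)
next
  fix x a
  show "G (\<lambda>k j. a * x k j) = \<bar>a\<bar> * G x"
    using nrm2_scale[of a "\<lambda>k j. x k j / xs k j"] by (simp add: G_eq real_sqrt_mult)
next
  fix x y
  have "(\<lambda>(k, j). sqrt (\<omega> k j) * ((x k j + y k j) / xs k j)) =
     (\<lambda>kj. (case kj of (k, j) \<Rightarrow> sqrt (\<omega> k j) * (x k j / xs k j)) + (case kj of (k, j) \<Rightarrow> sqrt (\<omega> k j) * (y k j / xs k j)))"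
    by (auto simp: fun_eq_iff add_divide_distrib distrib_left)
  then show "G (\<lambda>k j. x k j + y k j) \<le> G x + G y"
    unfolding G_def by (simp only: L2_set_triangle_ineq)
qed

lemma S_eqI:
  assumes "x \<in> S" "\<And>k j. k \<in> L \<Longrightarrow> j < d k \<Longrightarrow> x k j = xs k j"
  shows "x = xs"
proof (intro ext)
  fix k j show "x k j = xs k j"
    using assms xs_Spp by (cases "k \<in> L \<and> j < d k") (auto simp: sphere_Spp_def sphere_S_def space_R_def)
qed

text \<open>By \<open>s_map_xs\<close> the weights from the normalisation are proportional to
  \<open>xs k j powr p k\<close>, so the mean that is subtracted is \<open>avg\<close>.\<close>

lemma log_deriv_H_xs:
  assumes e: "e \<longlonglongrightarrow> 0" "\<And>n. e n \<noteq> 0"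
    and X: "\<And>l j. l \<in> L \<Longrightarrow> j < d l \<Longrightarrow> log_deriv e (\<lambda>n. X n l j) (xs l j) (w l j)"
    and k: "k \<in> L" "j < d k"
  shows "log_deriv e (\<lambda>n. H (X n) k j) (xs k j) (M w k j - avg k (M w k))"
proof -
  let ?a = "(\<Lambda> xs powr (1 / (p k - 1))) powr p k"
  have a: "0 < ?a" using \<Lambda>_pos[OF xs_positive] by simp
  have s: "s_map f m d p i k xs j powr p k = ?a * xs k j powr p k" if "j < d k" for j
    using that k xs_pos[OF k(1) that] by (simp add: s_map_xs powr_mult)
  have "(\<Sum>j<d k. s_map f m d p i k xs j powr p k) = ?a"
    using Spp_sum[OF xs_Spp k(1)] by (simp add: s sum_distrib_left[symmetric])
  moreover have "(\<Sum>j<d k. s_map f m d p i k xs j powr p k * (1 / (p k - 1) * cnd xs k (Y xs w k) j)) = ?a * avg k (M w k)"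
    by (simp add: s avg_def M_def sum_distrib_left mult_ac)
  ultimately have "(\<Sum>j<d k. s_map f m d p i k xs j powr p k * (1 / (p k - 1) * cnd xs k (Y xs w k) j)) /
     (\<Sum>j<d k. s_map f m d p i k xs j powr p k) = avg k (M w k)" using a by simp
  then show ?thesis using log_deriv_H[OF e xs_positive X k]
    by (simp add: H_xs M_def)
qed

text \<open>The norm of each mode is 1 along the sequence, so its logarithmic derivative, which is
  this average, vanishes.\<close>

lemma avg_tangent:
  assumes e: "e \<longlonglongrightarrow> 0" "\<And>n. e n \<noteq> 0"
    and X: "\<And>l j. l \<in> L \<Longrightarrow> j < d l \<Longrightarrow> log_deriv e (\<lambda>n. X n l j) (xs l j) (w l j)"
    and XS: "\<And>n. X n \<in> S" and k: "k \<in> L"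
  shows "avg k (w k) = 0"
proof -
  have "log_deriv e (\<lambda>n. pnorm (p k) (d k) (X n k)) (pnorm (p k) (d k) (xs k)) (avg k (w k))"
    using log_deriv_pnorm_mode[OF e xs_positive X k] Spp_sum[OF xs_Spp k] by (simp add: avg_def)
  moreover have "pnorm (p k) (d k) (X n k) = 1" for n
    using XS[of n] k by (auto simp: sphere_Spp_def sphere_S_def)
  ultimately have "(\<lambda>n. 0::real) \<longlonglongrightarrow> avg k (w k)" using pnorm_xs[OF k] by (simp add: log_deriv_def)
  then show ?thesis by (simp add: LIMSEQ_const_iff)
qed

lemma tendsto_nrm2:
  assumes "\<And>k j. k \<in> L \<Longrightarrow> j < d k \<Longrightarrow> (\<lambda>n. w n k j) \<longlonglongrightarrow> v k j"
  shows "(\<lambda>n. nrm2 (w n)) \<longlonglongrightarrow> nrm2 v"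
  unfolding nrm2_def using assms by (intro tendsto_intros) auto

text \<open>If no neighbourhood and factor worked, a sequence of violations would produce, after rescaling
  and passing to a subsequence, a tangent direction \<open>w\<close> on which the linearised map does not contract.\<close>

lemma local_contraction:
  "\<exists>\<delta>>0. \<exists>\<nu>. 0 < \<nu> \<and> \<nu> < 1 \<and> (\<forall>x\<in>S. G (\<lambda>k j. x k j - xs k j) < \<delta> \<longrightarrow>
     G (\<lambda>k j. H x k j - xs k j) \<le> \<nu> * G (\<lambda>k j. x k j - xs k j))"
proof (rule ccontr)
  assume neg: "\<not> ?thesis"
  \<comment> \<open>The shift to \<open>Suc (Suc n)\<close> keeps \<open>\<nu> 0\<close> strictly
    positive, as a contraction factor must be.\<close>
  define \<delta> \<nu> where "\<delta> = (\<lambda>n. 1 / real (Suc n))" and "\<nu> = (\<lambda>n. 1 - 1 / real (Suc (Suc n)))"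
  have "\<exists>x\<in>S. G (\<lambda>k j. x k j - xs k j) < \<delta> n \<and>
     \<nu> n * G (\<lambda>k j. x k j - xs k j) < G (\<lambda>k j. H x k j - xs k j)" for n
  proof -
    have pos: "0 < \<delta> n" "0 < \<nu> n" "\<nu> n < 1" by (auto simp: \<delta>_def \<nu>_def)
    show ?thesis
    proof (rule ccontr)
      assume "\<not> ?thesis"
      then have "\<forall>x\<in>S. G (\<lambda>k j. x k j - xs k j) < \<delta> n \<longrightarrow>
          G (\<lambda>k j. H x k j - xs k j) \<le> \<nu> n * G (\<lambda>k j. x k j - xs k j)"
        by (auto simp: not_less dest: leD)
      with pos neg show False by blast
    qed
  qed
  then have "\<forall>n. \<exists>x. x \<in> S \<and> G (\<lambda>k j. x k j - xs k j) < \<delta> n \<and>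
     \<nu> n * G (\<lambda>k j. x k j - xs k j) < G (\<lambda>k j. H x k j - xs k j)" by blast
  from choice[OF this] obtain x where xS: "\<And>n. x n \<in> S" and x\<delta>: "\<And>n. G (\<lambda>k j. x n k j - xs k j) < \<delta> n"
    and x\<nu>: "\<And>n. \<nu> n * G (\<lambda>k j. x n k j - xs k j) < G (\<lambda>k j. H (x n) k j - xs k j)"
    by blast
  define e where "e = (\<lambda>n. G (\<lambda>k j. x n k j - xs k j))"
  define w where "w = (\<lambda>n k j. (x n k j / xs k j - 1) / e n)"
  \<comment> \<open>At \<open>xs\<close> both sides of the violated inequality would be 0, while the
    violation is strict.\<close>
  have e_pos: "0 < e n" for n
  proof (rule ccontr)
    assume "\<not> 0 < e n"
    then have "e n = 0" using G_nonneg by (metis e_def less_eq_real_def)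
    then have "x n = xs" using G_eq_0_imp[of "\<lambda>k j. x n k j - xs k j"]
      by (intro S_eqI xS) (auto simp: e_def)
    then show False using x\<nu>[of n] H_xs by (simp add: G_eq nrm2_def)
  qed
  have "\<delta> \<longlonglongrightarrow> 0" using LIMSEQ_inverse_real_of_nat by (simp add: \<delta>_def inverse_eq_divide)
  have e0: "e \<longlonglongrightarrow> 0"
    by (rule tendsto_sandwich[OF _ _ tendsto_const \<open>\<delta> \<longlonglongrightarrow> 0\<close>])
       (use e_pos x\<delta> in \<open>auto simp: less_imp_le e_def\<close>)
  have \<nu>1: "\<nu> \<longlonglongrightarrow> 1"
  proof -
    have "(\<lambda>n. 1 - \<delta> (Suc n)) \<longlonglongrightarrow> 1 - 0"
      using \<open>\<delta> \<longlonglongrightarrow> 0\<close> by (intro tendsto_diff tendsto_const) (simp only: filterlim_sequentially_Suc)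
    then show ?thesis by (simp add: \<nu>_def \<delta>_def)
  qed
  have rel: "nrm2 (\<lambda>k j. (y k j / xs k j - 1) / e n) = (G (\<lambda>k j. y k j - xs k j) / e n)\<^sup>2" for y n
  proof -
    have "nrm2 (\<lambda>k j. (y k j / xs k j - 1) / e n) = nrm2 (\<lambda>k j. 1 / e n * ((y k j - xs k j) / xs k j))"
      unfolding nrm2_def
    proof (intro sum.cong refl)
      fix k j assume "k \<in> L" "j \<in> {..<d k}"
      then have "0 < xs k j" using xs_pos by simp
      then show "\<omega> k j * ((y k j / xs k j - 1) / e n)\<^sup>2 = \<omega> k j * (1 / e n * ((y k j - xs k j) / xs k j))\<^sup>2"
        by (simp add: diff_divide_distrib)
    qed
    then show ?thesis unfolding nrm2_scale by (simp add: G_square power_divide)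
  qed
  have w1: "nrm2 (w n) = 1" for n
  proof -
    have "nrm2 (w n) = (e n / e n)\<^sup>2" unfolding w_def rel by (simp only: e_def)
    then show ?thesis using e_pos[of n] by simp
  qed
  have bd: "Bseq (\<lambda>n. w n k j)" if "k \<in> L" "j < d k" for k j
  proof (rule BseqI')
    fix n
    have "\<omega> k j * (w n k j)\<^sup>2 \<le> 1" using nrm2_term_le[OF that, of "w n"] w1[of n] by simp
    then have "(w n k j)\<^sup>2 \<le> 1 / \<omega> k j" using \<omega>_pos[OF that] by (simp add: field_simps)
    then have "sqrt ((w n k j)\<^sup>2) \<le> sqrt (1 / \<omega> k j)" by (rule real_sqrt_le_mono)
    then show "norm (w n k j) \<le> sqrt (1 / \<omega> k j)" by simp
  qed
  have "\<exists>\<sigma>::nat\<Rightarrow>nat. strict_mono \<sigma> \<and>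
      (\<forall>kj\<in>Sigma L (\<lambda>k. {..<d k}). convergent ((\<lambda>n. w n (fst kj) (snd kj)) \<circ> \<sigma>))"
    by (rule convergent_subsequence_finite_family) (auto intro: bd)
  then obtain \<sigma> :: "nat \<Rightarrow> nat" where \<sigma>: "strict_mono \<sigma>"
    and conv: "\<And>k j. k \<in> L \<Longrightarrow> j < d k \<Longrightarrow> convergent (\<lambda>n. w (\<sigma> n) k j)"
    by (force simp: comp_def)
  define v where "v = (\<lambda>k j. lim (\<lambda>n. w (\<sigma> n) k j))"
  have wv: "(\<lambda>n. w (\<sigma> n) k j) \<longlonglongrightarrow> v k j" if "k \<in> L" "j < d k" for k j
    using conv[OF that] by (simp add: v_def convergent_LIMSEQ_iff)
  define e' X where "e' = (\<lambda>n. e (\<sigma> n))" and "X = (\<lambda>n. x (\<sigma> n))"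
  have e': "e' \<longlonglongrightarrow> 0" "\<And>n. e' n \<noteq> 0"
    using LIMSEQ_subseq_LIMSEQ[OF e0 \<sigma>] e_pos by (auto simp: e'_def comp_def less_imp_neq[symmetric])
  have X_pos: "0 < X n k j" if "k \<in> L" "j < d k" for n k j
    using Spp_positive[OF xS[of "\<sigma> n"]] that by (simp add: X_def positive_def)
  have ld: "log_deriv e' (\<lambda>n. X n k j) (xs k j) (v k j)" if "k \<in> L" "j < d k" for k j
    using wv[OF that] unfolding log_deriv_iff_relative[OF e' xs_pos[OF that] X_pos[OF that]]
    by (simp add: w_def X_def e'_def)
  let ?u = "\<lambda>k j. M v k j - avg k (M v k)"
  have "(\<lambda>n. (H (X n) k j / xs k j - 1) / e' n) \<longlonglongrightarrow> ?u k j" if "k \<in> L" "j < d k" for k j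
    using log_deriv_H_xs[OF e' ld that] log_deriv_iff_relative[OF e' log_deriv_pos[OF log_deriv_H_xs[OF e' ld that]]]
    by simp
  then have lim: "(\<lambda>n. nrm2 (\<lambda>k j. (H (X n) k j / xs k j - 1) / e' n)) \<longlonglongrightarrow> nrm2 ?u"
    by (rule tendsto_nrm2)
  have "(\<nu> (\<sigma> n))\<^sup>2 \<le> nrm2 (\<lambda>k j. (H (X n) k j / xs k j - 1) / e' n)" for n
  proof -
    have "\<nu> (\<sigma> n) \<le> G (\<lambda>k j. H (X n) k j - xs k j) / e' n"
      using x\<nu>[of "\<sigma> n"] e_pos[of "\<sigma> n"] by (simp add: X_def e'_def e_def field_simps)
    then show ?thesis unfolding e'_def rel by (intro power_mono) (auto simp: \<nu>_def)
  qed
  moreover have "(\<lambda>n. (\<nu> (\<sigma> n))\<^sup>2) \<longlonglongrightarrow> 1\<^sup>2"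
    using LIMSEQ_subseq_LIMSEQ[OF \<nu>1 \<sigma>] by (intro tendsto_power) (simp add: comp_def)
  ultimately have "1\<^sup>2 \<le> nrm2 ?u" using lim by (intro LIMSEQ_le) auto
  moreover have "(\<lambda>n. nrm2 (w (\<sigma> n))) \<longlonglongrightarrow> nrm2 v" by (rule tendsto_nrm2) (rule wv)
  then have v1: "nrm2 v = 1" by (simp add: w1 LIMSEQ_const_iff)
  ultimately have "nrm2 v \<le> nrm2 ?u" by simp
  moreover have "avg k (v k) = 0" if "k \<in> L" for k
    by (rule avg_tangent[OF e' ld _ that]) (auto simp: X_def xS)
  ultimately have "v k j = 0" if "k \<in> L" "j < d k" for k j
    using nrm2_strict that by blast
  then have "nrm2 v = 0" by (simp add: nrm2_def)
  then show False using v1 by simp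
qed

end

section \<open>Global convergence\<close>

context tensor_setup
begin

text \<open>\<open>close R x y\<close> says that, mode by mode, the Hilbert projective distance of \<open>x\<close> and \<open>y\<close> is at
  most \<open>ln R\<close>.\<close>

definition close :: "real \<Rightarrow> point \<Rightarrow> point \<Rightarrow> bool" where
  "close R x y \<longleftrightarrow> (\<forall>l\<in>L. \<exists>\<alpha>>0. \<forall>j<d l. \<alpha> * y l j \<le> x l j \<and> x l j \<le> R * \<alpha> * y l j)"

lemma close_mono:
  assumes "close R x y" "R \<le> T" "positive y"
  shows "close T x y"
  unfolding close_def
proof
  fix l assume l: "l \<in> L"
  then obtain \<alpha> where a: "0 < \<alpha>" "\<forall>j<d l. \<alpha> * y l j \<le> x l j \<and> x l j \<le> R * \<alpha> * y l j"
    using assms(1) unfolding close_def by blast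
  have "R * \<alpha> * y l j \<le> T * \<alpha> * y l j" if "j < d l" for j
    using assms(2,3) a(1) l that by (intro mult_right_mono) (auto simp: positive_def less_imp_le)
  then show "\<exists>\<alpha>>0. \<forall>j<d l. \<alpha> * y l j \<le> x l j \<and> x l j \<le> T * \<alpha> * y l j"
    using a by (meson order_trans)
qed

lemma close_trans:
  assumes "close R x y" "close T y z" "0 < R"
  shows "close (R * T) x z"
  unfolding close_def
proof
  fix l assume l: "l \<in> L"
  obtain \<alpha> where a: "0 < \<alpha>" "\<forall>j<d l. \<alpha> * y l j \<le> x l j \<and> x l j \<le> R * \<alpha> * y l j"
    using assms(1) l unfolding close_def by blast
  obtain \<beta> where b: "0 < \<beta>" "\<forall>j<d l. \<beta> * z l j \<le> y l j \<and> y l j \<le> T * \<beta> * z l j"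
    using assms(2) l unfolding close_def by blast
  have "\<alpha> * \<beta> * z l j \<le> x l j \<and> x l j \<le> R * T * (\<alpha> * \<beta>) * z l j" if "j < d l" for j
  proof
    have aj: "\<alpha> * y l j \<le> x l j" "x l j \<le> R * \<alpha> * y l j" using a(2) that by blast+
    have "\<alpha> * (\<beta> * z l j) \<le> \<alpha> * y l j" using a b that by (intro mult_left_mono) auto
    then show "\<alpha> * \<beta> * z l j \<le> x l j" using aj by (simp add: mult.assoc)
    have "R * \<alpha> * y l j \<le> R * \<alpha> * (T * \<beta> * z l j)"
      using a b that assms(3) by (intro mult_left_mono) auto
    then show "x l j \<le> R * T * (\<alpha> * \<beta>) * z l j" using aj by (simp add: mult_ac)
  qed
  then show "\<exists>\<alpha>>0. \<forall>j<d l. \<alpha> * z l j \<le> x l j \<and> x l j \<le> R * T * \<alpha> * z l j"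
    using a b by (intro exI[of _ "\<alpha> * \<beta>"]) auto
qed

text \<open>All maps involved are monotone and homogeneous. A spread \<open>R\<close> becomes
  \<open>R powr (m - 1)\<close> in \<open>gr i\<close>, then \<open>R powr c\<close> in
  \<open>gr k\<close>, and the root turns it into \<open>R powr (c / (p k - 1))\<close>, at most
  \<open>R\<close>. Normalisation only rescales each mode.\<close>

lemma close_H:
  assumes x: "positive x" and y: "positive y" and R: "1 \<le> R" and xy: "close R x y"
  shows "close R (H x) (H y)"
proof -
  obtain \<alpha> where \<alpha>: "\<And>l. l \<in> L \<Longrightarrow> 0 < \<alpha> l"
      "\<And>l j. l \<in> L \<Longrightarrow> j < d l \<Longrightarrow> \<alpha> l * y l j \<le> x l j \<and> x l j \<le> R * \<alpha> l * y l j"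
    using xy unfolding close_def by metis
  define \<gamma> where "\<gamma> = (\<Prod>l\<in>L. \<alpha> l)"
  have \<gamma>: "0 < \<gamma>" unfolding \<gamma>_def using \<alpha>(1) by (intro prod_pos) auto
  have R0: "0 < R" using R by simp
  have yp: "0 < y l j" if "l \<in> L" "j < d l" for l j using y that by (simp add: positive_def)
  have xp: "0 < x l j" if "l \<in> L" "j < d l" for l j using x that by (simp add: positive_def)
  have gi: "\<gamma> * gr i y a \<le> gr i x a \<and> gr i x a \<le> R powr (real m - 1) * \<gamma> * gr i y a" for a
  proof
    have "gr i (\<lambda>l j. \<alpha> l * y l j) a \<le> gr i x a"
      using \<alpha> yp by (intro grad_mono) (auto simp: less_imp_le)
    then show "\<gamma> * gr i y a \<le> gr i x a" by (simp add: grad_scale \<gamma>_def)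
    have "gr i x a \<le> gr i (\<lambda>l j. R * \<alpha> l * y l j) a"
      using \<alpha> xp by (intro grad_mono) (auto simp: less_imp_le)
    also have "\<dots> = (\<Prod>l\<in>L. R * \<alpha> l) * gr i y a" by (rule grad_scale)
    also have "(\<Prod>l\<in>L. R * \<alpha> l) = R powr (real m - 1) * \<gamma>"
      using R0 im m2 by (simp add: prod.distrib \<gamma>_def powr_realpow[symmetric] of_nat_diff)
    finally show "gr i x a \<le> R powr (real m - 1) * \<gamma> * gr i y a" .
  qed
  \<comment> \<open>\<open>A l\<close> is the scaling of mode \<open>l\<close> between the two
    extended points and \<open>B l\<close> the spread around it.\<close>
  define A where "A = (\<lambda>l. if l = i then \<gamma> powr (q - 1) else \<alpha> l)"
  define B where "B = (\<lambda>l. if l = i then R powr ((real m - 1) * (q - 1)) else R)"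
  have A_pos: "0 < A l" if "l < m" for l using that \<alpha>(1) \<gamma> by (auto simp: A_def)
  have B_pos: "0 < B l" for l using R0 by (auto simp: B_def)
  have ext: "A l * ext y l j \<le> ext x l j \<and> ext x l j \<le> B l * A l * ext y l j" if lj: "l < m" "j < d l" for l j
  proof (cases "l = i")
    case True
    have g: "0 < gr i y j" "0 < gr i x j" using gi_pos x y lj True by auto
    have "(\<gamma> * gr i y j) powr (q - 1) \<le> gr i x j powr (q - 1)"
      using gi[of j] g \<gamma> q_gt_1 by (intro powr_mono2) auto
    moreover have "gr i x j powr (q - 1) \<le> (R powr (real m - 1) * \<gamma> * gr i y j) powr (q - 1)"
      using gi[of j] g q_gt_1 by (intro powr_mono2) auto
    ultimately show ?thesis using True lj g \<gamma> x y
      by (simp add: ext_simps A_def B_def powr_mult powr_powr mult_ac)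
  next
    case False
    then show ?thesis using \<alpha>(2)[of l j] lj by (simp add: ext_simps A_def B_def)
  qed
  show ?thesis unfolding close_def
  proof
    fix k assume k: "k \<in> L"
    then have km: "k < m" by simp
    define P where "P = (\<Prod>l\<in>{..<m}-{k}. A l)"
    have P: "0 < P" unfolding P_def using A_pos by (intro prod_pos) auto
    have PB: "(\<Prod>l\<in>{..<m}-{k}. B l) = R powr c"
    proof -
      have "(\<Prod>l\<in>{..<m}-{k}. B l) = B i * (\<Prod>l\<in>{..<m}-{k}-{i}. B l)"
        using k im by (intro prod.remove) auto
      also have "(\<Prod>l\<in>{..<m}-{k}-{i}. B l) = (\<Prod>l\<in>{..<m}-{k}-{i}. R)"
        by (intro prod.cong) (auto simp: B_def)
      also have "\<dots> = R powr (real m - 2)"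
        using R0 k im m2 by (simp add: powr_realpow[symmetric] of_nat_diff)
      also have "B i * R powr (real m - 2) = R powr ((real m - 1) * (q - 1) + (real m - 2))"
        by (simp add: B_def powr_add)
      also have "(real m - 1) * (q - 1) + (real m - 2) = c" by (simp add: c_def algebra_simps)
      finally show ?thesis .
    qed
    let ?t = "1 / (p k - 1)"
    let ?sx = "s_map f m d p i k x" and ?sy = "s_map f m d p i k y"
    have pk: "0 < p k - 1" using p_gt_1[OF k] by simp
    have s: "P powr ?t * ?sy j \<le> ?sx j \<and> ?sx j \<le> R * P powr ?t * ?sy j" if j: "j < d k" for j
    proof
      have gp: "0 < gr k (ext y) j" "0 < gr k (ext x) j" using grad_ext_pos x y km j by auto
      have "gr k (\<lambda>l j. A l * ext y l j) j \<le> gr k (ext x) j"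
        using ext A_pos ext_pos[OF y] by (intro grad_mono) (auto simp: less_imp_le)
      then have "P * gr k (ext y) j \<le> gr k (ext x) j" by (simp add: grad_scale P_def)
      then have "(P * gr k (ext y) j) powr ?t \<le> gr k (ext x) j powr ?t"
        using P gp pk by (intro powr_mono2) auto
      then show "P powr ?t * ?sy j \<le> ?sx j" using P gp k j by (simp add: s_map_eq x y powr_mult)
      have "gr k (ext x) j \<le> gr k (\<lambda>l j. B l * A l * ext y l j) j"
        using ext ext_pos[OF x] by (intro grad_mono) (auto simp: less_imp_le)
      also have "\<dots> = R powr c * P * gr k (ext y) j" unfolding grad_scale by (simp add: prod.distrib PB P_def)
      finally have "gr k (ext x) j powr ?t \<le> (R powr c * P * gr k (ext y) j) powr ?t"
        using gp pk by (intro powr_mono2) auto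
      also have "\<dots> = R powr (c / (p k - 1)) * (P powr ?t * gr k (ext y) j powr ?t)"
        using P gp by (simp add: powr_mult powr_powr mult_ac)
      also have "\<dots> \<le> R powr 1 * (P powr ?t * gr k (ext y) j powr ?t)"
        using R c_le[OF k] pk by (intro mult_right_mono powr_mono) (auto simp: field_simps)
      finally show "?sx j \<le> R * P powr ?t * ?sy j" using R0 k j by (simp add: s_map_eq x y mult_ac)
    qed
    let ?Nx = "pnorm (p k) (d k) ?sx" and ?Ny = "pnorm (p k) (d k) ?sy"
    have N: "0 < ?Nx" "0 < ?Ny" using pnorm_s_map_pos x y k by auto
    have "P powr ?t * ?Ny / ?Nx * H y k j \<le> H x k j \<and> H x k j \<le> R * (P powr ?t * ?Ny / ?Nx) * H y k j"
      if j: "j < d k" for j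
      using s[OF j] N k j by (simp add: H_eq divide_right_mono)
    moreover have "0 < P powr ?t * ?Ny / ?Nx" using P N by simp
    ultimately show "\<exists>\<alpha>>0. \<forall>j<d k. \<alpha> * H y k j \<le> H x k j \<and> H x k j \<le> R * \<alpha> * H y k j" by blast
  qed
qed

lemma close_iterates:
  assumes "positive x" "positive y" "1 \<le> R" "close R x y"
  shows "close R (hgpm_x f m d p i x n) (hgpm_x f m d p i y n)"
  using assms by (induction n) (auto intro: close_H iterates_positive)

text \<open>The entrywise geometric mean with exponent \<open>N / (N + 1)\<close> lies on a geodesic
  of the Hilbert distance and divides it in the ratio 1 to \<open>N\<close>.\<close>

lemma close_interpolate:
  assumes x: "positive x" and y: "positive y" and r: "1 \<le> r" and xy: "close (r ^ Suc N) x y"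
  shows "\<exists>z. positive z \<and> close r x z \<and> close (r ^ N) z y"
proof -
  define t where "t = real N / real (Suc N)"
  define z where "z = (\<lambda>l j. y l j * (x l j / y l j) powr t)"
  have t: "0 \<le> t" "t \<le> 1" "1 - t = 1 / real (Suc N)"
    by (auto simp: t_def field_simps)
  have r0: "0 < r" using r by simp
  have pos: "0 < x l j" "0 < y l j" if "l \<in> L" "j < d l" for l j
    using x y that by (auto simp: positive_def)
  have "0 < z l j" if "l \<in> L" "j < d l" for l j
    using pos[OF that] by (simp add: z_def)
  then have zp: "positive z" by (simp add: positive_def)
  have rt: "(r ^ Suc N) powr t = r ^ N" "(r ^ Suc N) powr (1 - t) = r"
  proof -
    have *: "(r ^ Suc N) powr u = r powr (real (Suc N) * u)" for u
      using r0 by (simp add: powr_powr powr_realpow[symmetric] del: power_Suc)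
    show "(r ^ Suc N) powr t = r ^ N" unfolding * using r0 by (simp add: t_def powr_realpow del: of_nat_Suc)
    show "(r ^ Suc N) powr (1 - t) = r" unfolding * t(3) using r0 by (simp del: of_nat_Suc)
  qed
  have "(\<exists>\<alpha>>0. \<forall>j<d l. \<alpha> * z l j \<le> x l j \<and> x l j \<le> r * \<alpha> * z l j) \<and>
        (\<exists>\<alpha>>0. \<forall>j<d l. \<alpha> * y l j \<le> z l j \<and> z l j \<le> r ^ N * \<alpha> * y l j)" if l: "l \<in> L" for l
  proof -
    obtain \<alpha> where a: "0 < \<alpha>" "\<And>j. j < d l \<Longrightarrow> \<alpha> * y l j \<le> x l j \<and> x l j \<le> r ^ Suc N * \<alpha> * y l j"
      using xy l unfolding close_def by blast
    have \<rho>: "\<alpha> powr u \<le> (x l j / y l j) powr u \<and> (x l j / y l j) powr u \<le> (r ^ Suc N) powr u * \<alpha> powr u"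
      if "j < d l" "0 \<le> u" for j u
    proof -
      have "\<alpha> \<le> x l j / y l j" "x l j / y l j \<le> r ^ Suc N * \<alpha>"
        using a(2)[OF that(1)] pos[OF l that(1)] by (auto simp: field_simps)
      then have "\<alpha> powr u \<le> (x l j / y l j) powr u" "(x l j / y l j) powr u \<le> (r ^ Suc N * \<alpha>) powr u"
        using a(1) that(2) pos[OF l that(1)] by (auto intro!: powr_mono2)
      then show ?thesis using r0 a(1) by (simp add: powr_mult)
    qed
    have xz: "x l j = (x l j / y l j) powr (1 - t) * z l j" if "j < d l" for j
    proof -
      have "(x l j / y l j) powr (1 - t) * (x l j / y l j) powr t = x l j / y l j"
        using pos[OF l that] by (simp add: powr_add[symmetric])
      then have "y l j * ((x l j / y l j) powr (1 - t) * (x l j / y l j) powr t) = x l j"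
        using pos[OF l that] by simp
      then show ?thesis by (simp add: z_def mult.left_commute)
    qed
    have zj: "0 < z l j" if "j < d l" for j using zp l that by (simp add: positive_def)
    have "\<alpha> powr (1 - t) * z l j \<le> x l j \<and> x l j \<le> r * \<alpha> powr (1 - t) * z l j" if "j < d l" for j
    proof -
      have "\<alpha> powr (1 - t) * z l j \<le> (x l j / y l j) powr (1 - t) * z l j"
        "(x l j / y l j) powr (1 - t) * z l j \<le> r * \<alpha> powr (1 - t) * z l j"
        using \<rho>[OF that, of "1 - t"] t zj[OF that] rt by (auto intro!: mult_right_mono simp: less_imp_le)
      then show ?thesis using xz[OF that] by linarith
    qed
    moreover have "\<alpha> powr t * y l j \<le> z l j \<and> z l j \<le> r ^ N * \<alpha> powr t * y l j" if "j < d l" for j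
    proof -
      have "\<alpha> powr t * y l j \<le> (x l j / y l j) powr t * y l j"
        "(x l j / y l j) powr t * y l j \<le> r ^ N * \<alpha> powr t * y l j"
        using \<rho>[OF that, of t] t pos[OF l that] rt by (auto intro!: mult_right_mono simp: less_imp_le)
      then show ?thesis by (simp add: z_def mult.commute)
    qed
    moreover have "0 < \<alpha> powr (1 - t)" "0 < \<alpha> powr t" using a(1) by simp_all
    ultimately show ?thesis by blast
  qed
  then have "close r x z" "close (r ^ N) z y" unfolding close_def by blast+
  with zp show ?thesis by blast
qed

lemma closeI_ratio:
  assumes "positive y" "0 < B" "\<And>l j. l \<in> L \<Longrightarrow> j < d l \<Longrightarrow> 1 / B \<le> x l j / y l j \<and> x l j / y l j \<le> B"
  shows "close (B\<^sup>2) x y"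
  unfolding close_def
proof
  fix l assume l: "l \<in> L"
  have "1 / B * y l j \<le> x l j \<and> x l j \<le> B\<^sup>2 * (1 / B) * y l j" if "j < d l" for j
    using assms(3)[OF l that] assms(1,2) l that
    by (simp add: positive_def field_simps power2_eq_square)
  then show "\<exists>\<alpha>>0. \<forall>j<d l. \<alpha> * y l j \<le> x l j \<and> x l j \<le> B\<^sup>2 * \<alpha> * y l j"
    using assms(2) by (intro exI[of _ "1 / B"]) auto
qed

text \<open>The sum of all ratios and their inverses bounds each of them, so the Hilbert distance of
  two positive points is finite.\<close>

lemma close_exists:
  assumes x: "positive x" and y: "positive y" and r: "1 < r"
  shows "\<exists>N. close (r ^ N) x y"
proof -
  have pos: "0 < x l j" "0 < y l j" if "l \<in> L" "j < d l" for l j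
    using x y that by (auto simp: positive_def)
  define g where "g = (\<lambda>(l, j). x l j / y l j + y l j / x l j)"
  define B where "B = 1 + (\<Sum>lj\<in>Sigma L (\<lambda>l. {..<d l}). g lj)"
  have g0: "0 \<le> g lj" if mem: "lj \<in> Sigma L (\<lambda>l. {..<d l})" for lj
  proof -
    obtain l j where lj: "lj = (l, j)" "l \<in> L" "j < d l" using mem by auto
    then show ?thesis using pos[OF lj(2,3)] by (simp add: g_def)
  qed
  have B: "0 < B" unfolding B_def using g0 by (intro add_pos_nonneg sum_nonneg) auto
  have "1 / B \<le> x l j / y l j \<and> x l j / y l j \<le> B" if lj: "l \<in> L" "j < d l" for l j
  proof -
    have "g (l, j) \<le> (\<Sum>lj\<in>Sigma L (\<lambda>l. {..<d l}). g lj)"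
      using lj g0 by (intro member_le_sum) auto
    then have "x l j / y l j + y l j / x l j \<le> B" by (simp add: g_def B_def)
    moreover have "0 < x l j / y l j" "0 < y l j / x l j" using pos[OF lj] by auto
    ultimately have "x l j / y l j \<le> B" "y l j / x l j \<le> B" by linarith+
    then show ?thesis using pos[OF lj] B by (simp add: field_simps)
  qed
  then have "close (B\<^sup>2) x y" by (rule closeI_ratio[OF y B])
  moreover obtain N where "B\<^sup>2 < r ^ N" using real_arch_pow[OF r] by blast
  ultimately show ?thesis using close_mono[OF _ _ y] less_imp_le by blast
qed

end

section \<open>From local attraction to attraction of every positive point\<close>

context critical_point
begin

definition conv :: "point \<Rightarrow> bool" where
  "conv x \<longleftrightarrow> (\<forall>k\<in>L. \<forall>j<d k. (\<lambda>n. hgpm_x f m d p i x n k j) \<longlonglongrightarrow> xs k j)"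

lemma iterates_add: "hgpm_x f m d p i x (n + N) = hgpm_x f m d p i (hgpm_x f m d p i x N) n"
  by (induction n) auto

lemma conv_shift: "conv (hgpm_x f m d p i x N) \<Longrightarrow> conv x"
  unfolding conv_def iterates_add[symmetric] by (blast intro: LIMSEQ_offset)

lemma G_tendsto_0:
  assumes "conv x"
  shows "(\<lambda>n. G (\<lambda>k j. hgpm_x f m d p i x n k j - xs k j)) \<longlonglongrightarrow> 0"
proof -
  have "(\<lambda>n. nrm2 (\<lambda>k j. (hgpm_x f m d p i x n k j - xs k j) / xs k j)) \<longlonglongrightarrow> nrm2 (\<lambda>k j. (xs k j - xs k j) / xs k j)"
  proof (rule tendsto_nrm2)
    fix k j assume kj: "k \<in> L" "j < d k"
    then have "(\<lambda>n. hgpm_x f m d p i x n k j) \<longlonglongrightarrow> xs k j" using assms unfolding conv_def by blast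
    then show "(\<lambda>n. (hgpm_x f m d p i x n k j - xs k j) / xs k j) \<longlonglongrightarrow> (xs k j - xs k j) / xs k j"
      using xs_pos[OF kj] by (intro tendsto_intros) auto
  qed
  then have "(\<lambda>n. nrm2 (\<lambda>k j. (hgpm_x f m d p i x n k j - xs k j) / xs k j)) \<longlonglongrightarrow> 0"
    by (simp add: nrm2_def)
  from tendsto_real_sqrt[OF this] show ?thesis by (simp add: G_eq)
qed

lemma conv_if_G_tendsto_0:
  assumes "(\<lambda>n. G (\<lambda>k j. hgpm_x f m d p i x n k j - xs k j)) \<longlonglongrightarrow> 0"
  shows "conv x"
  unfolding conv_def
proof (intro ballI allI impI)
  fix k j assume kj: "k \<in> L" "j < d k"
  let ?v = "\<lambda>n. (hgpm_x f m d p i x n k j - xs k j) / xs k j"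
  have lim: "(\<lambda>n. (G (\<lambda>k j. hgpm_x f m d p i x n k j - xs k j))\<^sup>2 / \<omega> k j) \<longlonglongrightarrow> 0\<^sup>2 / \<omega> k j"
    using \<omega>_pos[OF kj] by (intro tendsto_intros assms) auto
  have "(\<lambda>n. (?v n)\<^sup>2) \<longlonglongrightarrow> 0"
  proof (rule tendsto_sandwich[OF _ _ tendsto_const])
    show "(\<lambda>n. (G (\<lambda>k j. hgpm_x f m d p i x n k j - xs k j))\<^sup>2 / \<omega> k j) \<longlonglongrightarrow> 0" using lim by simp
    have "(?v n)\<^sup>2 \<le> (G (\<lambda>k j. hgpm_x f m d p i x n k j - xs k j))\<^sup>2 / \<omega> k j" for n
      using nrm2_term_le[OF kj, of "\<lambda>k j. (hgpm_x f m d p i x n k j - xs k j) / xs k j"] \<omega>_pos[OF kj]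
      unfolding G_square by (simp add: pos_le_divide_eq mult.commute)
    then show "\<forall>\<^sub>F n in sequentially. (?v n)\<^sup>2 \<le> (G (\<lambda>k j. hgpm_x f m d p i x n k j - xs k j))\<^sup>2 / \<omega> k j" by simp
  qed simp
  then have "(\<lambda>n. \<bar>?v n\<bar>) \<longlonglongrightarrow> 0" using tendsto_real_sqrt[of "\<lambda>n. (?v n)\<^sup>2" 0] by simp
  then have "?v \<longlonglongrightarrow> 0" by (rule tendsto_rabs_zero_cancel)
  then have "(\<lambda>n. ?v n * xs k j + xs k j) \<longlonglongrightarrow> 0 * xs k j + xs k j" by (intro tendsto_intros)
  then show "(\<lambda>n. hgpm_x f m d p i x n k j) \<longlonglongrightarrow> xs k j" using xs_pos[OF kj] by simp
qed

text \<open>The factor is below 1, so the ball is invariant, the local estimate can be iterated, and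
  the distance decays geometrically.\<close>

lemma basin_of_attraction: "\<exists>\<delta>>0. \<forall>x\<in>S. G (\<lambda>k j. x k j - xs k j) < \<delta> \<longrightarrow> conv x"
proof -
  obtain \<delta> \<nu> where \<delta>: "0 < \<delta>" and \<nu>: "0 < \<nu>" "\<nu> < 1"
    and contr: "\<And>x. x \<in> S \<Longrightarrow> G (\<lambda>k j. x k j - xs k j) < \<delta> \<Longrightarrow>
      G (\<lambda>k j. H x k j - xs k j) \<le> \<nu> * G (\<lambda>k j. x k j - xs k j)"
    using local_contraction by blast
  have "conv x" if x: "x \<in> S" and xd: "G (\<lambda>k j. x k j - xs k j) < \<delta>" for x
  proof (rule conv_if_G_tendsto_0)
    let ?g = "\<lambda>n. G (\<lambda>k j. hgpm_x f m d p i x n k j - xs k j)"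
    have le: "?g n \<le> \<nu> ^ n * ?g 0" for n
    proof (induction n)
      case (Suc n)
      have "\<nu> ^ n * ?g 0 \<le> 1 * ?g 0" using \<nu> by (intro mult_right_mono power_le_one G_nonneg) auto
      then have "?g n < \<delta>" using Suc xd by simp
      then have "?g (Suc n) \<le> \<nu> * ?g n" using contr[OF iterates_Spp[OF x]] by simp
      also have "\<dots> \<le> \<nu> * (\<nu> ^ n * ?g 0)" using Suc \<nu> by (intro mult_left_mono) auto
      finally show ?case by (simp add: mult_ac)
    qed simp
    have "(\<lambda>n. \<nu> ^ n * ?g 0) \<longlonglongrightarrow> 0" using \<nu> by (intro tendsto_mult_left_zero LIMSEQ_power_zero) auto
    from tendsto_sandwich[OF _ _ tendsto_const this] show "?g \<longlonglongrightarrow> 0"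
      using le G_nonneg by simp
  qed
  with \<delta> show ?thesis by blast
qed

text \<open>Both points have unit norms, which forces the unknown scaling to satisfy
  \<open>\<alpha> \<le> 1\<close> and \<open>1 \<le> r * \<alpha>\<close>. Projective closeness thus
  becomes a bound on the relative error.\<close>

lemma close_xs_ratio:
  assumes x: "x \<in> S" and cl: "close r x xs" and r: "1 \<le> r" and k: "k \<in> L" and j: "j < d k"
  shows "\<bar>x k j / xs k j - 1\<bar> \<le> r - 1"
proof -
  obtain \<alpha> where a: "0 < \<alpha>" "\<And>j. j < d k \<Longrightarrow> \<alpha> * xs k j \<le> x k j \<and> x k j \<le> r * \<alpha> * xs k j"
    using cl k unfolding close_def by blast
  have pk: "0 < p k" using p_gt_1[OF k] by simp
  have xp: "0 < x k j" if "j < d k" for j using Spp_positive[OF x] k that by (simp add: positive_def)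
  have sum: "(\<Sum>j<d k. (b * xs k j) powr p k) = b powr p k" if "0 < b" for b
  proof -
    have "(\<Sum>j<d k. (b * xs k j) powr p k) = (\<Sum>j<d k. b powr p k * xs k j powr p k)"
      using that xs_pos[OF k] by (intro sum.cong) (auto simp: powr_mult less_imp_le)
    then show ?thesis using Spp_sum[OF xs_Spp k] by (simp add: sum_distrib_left[symmetric])
  qed
  have "\<alpha> powr p k \<le> (\<Sum>j<d k. x k j powr p k)"
    unfolding sum[OF a(1), symmetric] using a xs_pos[OF k] pk
    by (intro sum_mono powr_mono2) (auto simp: less_imp_le)
  then have "\<alpha> powr p k \<le> 1 powr p k" using Spp_sum[OF x k] by simp
  then have a1: "\<alpha> \<le> 1" using pk powr_less_mono2[of "p k" 1 \<alpha>] by (meson not_less zero_le_one)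
  have ra: "0 < r * \<alpha>" using a r by simp
  have "(\<Sum>j<d k. x k j powr p k) \<le> (r * \<alpha>) powr p k"
    unfolding sum[OF ra, symmetric] using a xp pk
    by (intro sum_mono powr_mono2) (auto simp: less_imp_le)
  then have "1 powr p k \<le> (r * \<alpha>) powr p k" using Spp_sum[OF x k] by simp
  then have a2: "1 \<le> r * \<alpha>" using pk ra powr_less_mono2[of "p k" "r * \<alpha>" 1] by (meson not_less less_imp_le)
  have "\<alpha> \<le> x k j / xs k j" "x k j / xs k j \<le> r * \<alpha>"
    using a(2)[OF j] xs_pos[OF k j] by (auto simp: field_simps)
  moreover have "r * \<alpha> \<le> r" using a1 r by (simp add: mult_left_le)
  moreover have "1 - \<alpha> \<le> r - 1"
  proof -
    \<comment> \<open>Here \<open>\<alpha>\<close> is at least \<open>1 / r\<close>, and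
      \<open>r * (2 - r)\<close> is 1 minus the square of \<open>r - 1\<close>.\<close>
    have "2 - r \<le> \<alpha>"
    proof (rule ccontr)
      assume "\<not> 2 - r \<le> \<alpha>"
      then have "r * \<alpha> < r * (2 - r)" using r by (intro mult_strict_left_mono) auto
      also have "\<dots> \<le> 1" using zero_le_power2[of "r - 1"] by (simp add: power2_eq_square algebra_simps)
      finally show False using a2 by simp
    qed
    then show ?thesis by simp
  qed
  ultimately show ?thesis by linarith
qed

text \<open>One application of \<open>H\<close> moves \<open>x\<close> onto the spheres and keeps it
  close to \<open>xs\<close>; there \<open>close_xs_ratio\<close> bounds its
  \<open>G\<close>-distance from \<open>xs\<close>.\<close>

lemma close_imp_conv: "\<exists>r>1. \<forall>x. positive x \<longrightarrow> close r x xs \<longrightarrow> conv x"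
proof -
  obtain \<delta> where \<delta>: "0 < \<delta>" "\<And>x. x \<in> S \<Longrightarrow> G (\<lambda>k j. x k j - xs k j) < \<delta> \<Longrightarrow> conv x"
    using basin_of_attraction by blast
  \<comment> \<open>A uniform relative error \<open>\<epsilon>\<close> has \<open>G\<close>-norm
    \<open>\<epsilon> * sqrt T\<close>, and \<open>\<epsilon>\<close> is chosen to make this less
    than \<open>\<delta>\<close>.\<close>
  define T where "T = nrm2 (\<lambda>k j. 1)"
  define \<epsilon> where "\<epsilon> = \<delta> / (1 + sqrt T)"
  have T: "0 \<le> T" unfolding T_def by (rule nrm2_nonneg)
  have e: "0 < \<epsilon>" using \<delta>(1) T by (simp add: \<epsilon>_def add_pos_nonneg)
  have eT: "\<epsilon> * sqrt T < \<delta>" using \<delta>(1) T by (simp add: \<epsilon>_def field_simps add_pos_nonneg)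
  have "conv x" if x: "positive x" and cl: "close (1 + \<epsilon>) x xs" for x
  proof -
    have HS: "H x \<in> S" using x by (rule H_Spp)
    have "close (1 + \<epsilon>) (H x) (H xs)" using close_H[OF x xs_positive _ cl] e by simp
    then have cl': "close (1 + \<epsilon>) (H x) xs" by (simp add: H_xs)
    have "nrm2 (\<lambda>k j. (H x k j - xs k j) / xs k j) \<le> nrm2 (\<lambda>k j. \<epsilon> * 1)"
      unfolding nrm2_def
    proof (intro sum_mono mult_left_mono)
      fix k j assume kj: "k \<in> L" "j \<in> {..<d k}"
      have "\<bar>(H x k j - xs k j) / xs k j\<bar> \<le> \<bar>\<epsilon> * 1\<bar>"
        using close_xs_ratio[OF HS cl' _ kj(1), of j] e kj xs_pos[OF kj(1), of j] by (simp add: diff_divide_distrib)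
      then show "((H x k j - xs k j) / xs k j)\<^sup>2 \<le> (\<epsilon> * 1)\<^sup>2" by (rule abs_le_square_iff[THEN iffD1])
      show "0 \<le> \<omega> k j" using \<omega>_pos kj by (simp add: less_imp_le)
    qed
    also have "\<dots> = \<epsilon>\<^sup>2 * T" unfolding nrm2_scale T_def ..
    finally have "G (\<lambda>k j. H x k j - xs k j) \<le> sqrt (\<epsilon>\<^sup>2 * T)" unfolding G_eq by (rule real_sqrt_le_mono)
    also have "\<dots> = \<epsilon> * sqrt T" using e by (simp add: real_sqrt_mult)
    finally have "conv (H x)" using eT by (intro \<delta>(2) HS) simp
    then show ?thesis using conv_shift[of x 1] by simp
  qed
  with e show ?thesis by (intro exI[of _ "1 + \<epsilon>"]) auto
qed

text \<open>There are finitely many coordinates, so eventually all ratios to \<open>xs\<close> lie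
  between \<open>1 / sqrt r\<close> and \<open>sqrt r\<close>; \<open>closeI_ratio\<close> squares
  the bound.\<close>

lemma conv_imp_close:
  assumes z: "positive z" and c: "conv z" and r: "1 < r"
  shows "\<exists>n. close r (hgpm_x f m d p i z n) xs"
proof -
  let ?B = "sqrt r"
  have B: "1 < ?B" "0 < ?B" using r by (auto simp: real_less_rsqrt)
  have "\<forall>\<^sub>F n in sequentially. \<forall>kj\<in>Sigma L (\<lambda>k. {..<d k}). case kj of (k, j) \<Rightarrow>
      1 / ?B < hgpm_x f m d p i z n k j / xs k j \<and> hgpm_x f m d p i z n k j / xs k j < ?B"
  proof (rule eventually_ball_finite)
    show "\<forall>kj\<in>Sigma L (\<lambda>k. {..<d k}). \<forall>\<^sub>F n in sequentially. case kj of (k, j) \<Rightarrow>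
      1 / ?B < hgpm_x f m d p i z n k j / xs k j \<and> hgpm_x f m d p i z n k j / xs k j < ?B"
    proof
      fix u assume "u \<in> Sigma L (\<lambda>k. {..<d k})"
      then obtain k j where u: "u = (k, j)" and kj: "k < m" "k \<noteq> i" "j < d k" by auto
      then have kL: "k \<in> L" by simp
      have xk: "0 < xs k j" using xs_pos[OF kL kj(3)] .
      have "(\<lambda>n. hgpm_x f m d p i z n k j) \<longlonglongrightarrow> xs k j" using c kL kj(3) unfolding conv_def by blast
      then have "(\<lambda>n. hgpm_x f m d p i z n k j / xs k j) \<longlonglongrightarrow> xs k j / xs k j"
        using xk by (intro tendsto_divide tendsto_const) auto
      then have l: "(\<lambda>n. hgpm_x f m d p i z n k j / xs k j) \<longlonglongrightarrow> 1" using xk by simp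
      have "1 / ?B < 1" using B by simp
      then have "\<forall>\<^sub>F n in sequentially. 1 / ?B < hgpm_x f m d p i z n k j / xs k j \<and> hgpm_x f m d p i z n k j / xs k j < ?B"
        using order_tendstoD[OF l] B(1) by (intro eventually_conj) auto
      then show "\<forall>\<^sub>F n in sequentially. case u of (k, j) \<Rightarrow>
          1 / ?B < hgpm_x f m d p i z n k j / xs k j \<and> hgpm_x f m d p i z n k j / xs k j < ?B"
        by (simp add: u)
    qed
  qed auto
  then obtain n where n: "\<And>k j. k \<in> L \<Longrightarrow> j < d k \<Longrightarrow>
      1 / ?B < hgpm_x f m d p i z n k j / xs k j \<and> hgpm_x f m d p i z n k j / xs k j < ?B"
    by (fastforce dest!: eventually_happens)
  have "close (?B\<^sup>2) (hgpm_x f m d p i z n) xs"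
    using n by (intro closeI_ratio xs_positive B) (simp add: less_imp_le)
  then show ?thesis using r by auto
qed

text \<open>The map does not increase Hilbert distances, so the basin of attraction can be enlarged step by
  step along geometric interpolations towards \<open>xs\<close>.\<close>

lemma global_convergence:
  assumes "positive x"
  shows "conv x"
proof -
  obtain r where r: "1 < r" "\<And>x. positive x \<Longrightarrow> close r x xs \<Longrightarrow> conv x"
    using close_imp_conv by blast
  \<comment> \<open>Two steps of size \<open>\<rho>\<close> are composed: from the iterate of
    \<open>x\<close> to that of \<open>z\<close>, and from there to \<open>xs\<close>.\<close>
  define \<rho> where "\<rho> = sqrt r"
  have \<rho>: "1 < \<rho>" "\<rho> * \<rho> = r" using r(1) by (auto simp: \<rho>_def real_less_rsqrt)
  have "conv x" if "positive x" "close (\<rho> ^ N) x xs" for N x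
    using that
  proof (induction N arbitrary: x)
    case 0
    then show ?case using r close_mono[of 1 x xs r] xs_positive by simp
  next
    case (Suc N)
    obtain z where z: "positive z" "close \<rho> x z" "close (\<rho> ^ N) z xs"
      using close_interpolate[OF Suc.prems(1) xs_positive _ Suc.prems(2)] \<rho>(1) by auto
    have "conv z" using Suc.IH z by blast
    then obtain n where n: "close \<rho> (hgpm_x f m d p i z n) xs" using conv_imp_close z(1) \<rho>(1) by blast
    have "close \<rho> (hgpm_x f m d p i x n) (hgpm_x f m d p i z n)"
      using close_iterates[OF Suc.prems(1) z(1) _ z(2)] \<rho>(1) by simp
    from close_trans[OF this n] have "close r (hgpm_x f m d p i x n) xs" using \<rho> by simp
    then have "conv (hgpm_x f m d p i x n)" using r(2) iterates_positive[OF Suc.prems(1)] by blast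
    then show ?case by (rule conv_shift)
  qed
  then show ?thesis using close_exists[OF assms xs_positive \<rho>(1)] assms by blast
qed

section \<open>The norm of the tensor and the limits of the bounds\<close>

lemma conj_q: "1 / p i + 1 / q = 1" "(q - 1) * p i = q"
  using prange im by (auto simp: q_def hoelder_conj_def field_simps)

text \<open>Each of the \<open>m - 1\<close> terms with index in \<open>L\<close> is at most
  \<open>1 / ((m - 1) * q)\<close>, so together they fit into \<open>1 - 1 / p i\<close>.\<close>

lemma sum_inverse_exponents: "(\<Sum>k<m. 1 / p k) \<le> 1"
proof -
  have m1: "0 < real m - 1" using m2 by simp
  have "(\<Sum>k\<in>L. 1 / p k) \<le> (\<Sum>k\<in>L. 1 / ((real m - 1) * q))"
  proof (intro sum_mono divide_left_mono)
    fix k assume "k \<in> L"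
    then show "(real m - 1) * q \<le> p k" using pcond by (simp add: q_def)
    show "0 < p k * ((real m - 1) * q)" using p_gt_1[OF \<open>k \<in> L\<close>] m1 q_gt_1 by simp
  qed simp
  also have "\<dots> = 1 / q" using m1 by (simp only: sum_constant card_L) simp
  finally have "(\<Sum>k\<in>L. 1 / p k) \<le> 1 / q" .
  moreover have "(\<Sum>k<m. 1 / p k) = 1 / p i + (\<Sum>k\<in>L. 1 / p k)"
    using im by (intro sum.remove) auto
  ultimately show ?thesis using conj_q by simp
qed

text \<open>The divisor in mode \<open>i\<close> is the norm of \<open>ext xs i\<close>: as
  \<open>(q - 1) * p i = q\<close>, the relevant powers sum to \<open>\<Lambda> xs\<close>.\<close>

definition maximizer :: point where
  "maximizer k j = (if m \<le> k \<or> d k \<le> j then 0 else if k = i then ext xs i j / \<Lambda> xs powr (1 / p i) else xs k j)"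

lemma maximizer_pos: "k < m \<Longrightarrow> j < d k \<Longrightarrow> 0 < maximizer k j"
  using ext_pos[OF xs_positive, of k j] \<Lambda>_pos[OF xs_positive] xs_pos[of k j]
  by (cases "k = i") (simp_all add: maximizer_def)

lemma marg_maximizer:
  assumes "k < m" "j < d k"
  shows "marg xs k j = \<Lambda> xs * maximizer k j powr p k"
proof (cases "k = i")
  case True
  have L: "0 < \<Lambda> xs" by (rule \<Lambda>_pos[OF xs_positive])
  have g: "0 < gr i xs j" using gi_pos[OF xs_positive] assms True by simp
  have "maximizer i j powr p i = gr i xs j powr q / \<Lambda> xs"
    using assms True L g prange[rule_format, OF im] conj_q(2)
    by (simp add: maximizer_def ext_simps xs_positive powr_divide powr_powr)
  then show ?thesis using True assms L by (simp add: marg_i xs_positive)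
next
  case False
  then show ?thesis using assms by (simp add: marg_xs maximizer_def)
qed

lemma prod_maximizer:
  assumes "J \<in> I"
  shows "f J * (\<Prod>k<m. maximizer k (J k)) = W xs J / \<Lambda> xs powr (1 / p i)"
proof -
  have "(\<Prod>k<m. maximizer k (J k)) = maximizer i (J i) * (\<Prod>k\<in>L. maximizer k (J k))"
    using im by (intro prod.remove) auto
  also have "(\<Prod>k\<in>L. maximizer k (J k)) = (\<Prod>k\<in>L. ext xs k (J k))"
    using multi_idx_less[OF assms] by (intro prod.cong) (auto simp: maximizer_def ext_simps not_le[symmetric])
  also have "maximizer i (J i) * (\<Prod>k\<in>L. ext xs k (J k)) = (\<Prod>k<m. ext xs k (J k)) / \<Lambda> xs powr (1 / p i)"
    using im assms multi_idx_less[OF assms im] prod.remove[of "{..<m}" i "\<lambda>k. ext xs k (J k)"]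
    by (simp add: maximizer_def)
  finally show ?thesis by (simp add: W_def)
qed

lemma \<Lambda>_quotient: "\<Lambda> xs / \<Lambda> xs powr (1 / p i) = \<Lambda> xs powr (1 / q)"
proof -
  have L: "0 < \<Lambda> xs" by (rule \<Lambda>_pos[OF xs_positive])
  have "\<Lambda> xs powr (1 / p i) * \<Lambda> xs powr (1 / q) = \<Lambda> xs"
    using L by (simp only: powr_add[symmetric] conj_q(1)) simp
  then show ?thesis using L by (simp add: field_simps)
qed

lemma pnorm_maximizer:
  assumes "k < m"
  shows "pnorm (p k) (d k) (maximizer k) = 1"
proof -
  have L: "0 < \<Lambda> xs" by (rule \<Lambda>_pos[OF xs_positive])
  have "\<Lambda> xs * (\<Sum>j<d k. maximizer k j powr p k) = \<Lambda> xs"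
    using sum_marg[OF assms, of xs] assms by (simp add: marg_maximizer sum_distrib_left)
  then have "(\<Sum>j<d k. maximizer k j powr p k) = 1" using L by simp
  moreover have "(\<Sum>j<d k. \<bar>maximizer k j\<bar> powr p k) = (\<Sum>j<d k. maximizer k j powr p k)"
    using maximizer_pos[OF assms] by (intro sum.cong) (auto simp: less_imp_le)
  ultimately show ?thesis by (simp add: pnorm_def)
qed

lemma feval_maximizer: "feval f m d maximizer = \<Lambda> xs powr (1 / q)"
proof -
  have "feval f m d maximizer = (\<Sum>J\<in>I. W xs J / \<Lambda> xs powr (1 / p i))"
    unfolding feval_def by (intro sum.cong refl prod_maximizer)
  also have "\<dots> = \<Lambda> xs / \<Lambda> xs powr (1 / p i)" by (simp add: \<Lambda>_def sum_divide_distrib)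
  finally show ?thesis by (simp only: \<Lambda>_quotient)
qed

text \<open>Since the marginals of \<open>W xs\<close> are known, the weighted AM-GM inequality applied to the ratios
  \<open>x k j / maximizer k j\<close> bounds the multilinear form.\<close>

lemma feval_le:
  assumes nz: "\<forall>k<m. \<exists>j<d k. x k j \<noteq> 0"
  shows "\<bar>feval f m d x\<bar> \<le> \<Lambda> xs powr (1 / q) * (\<Prod>k<m. pnorm (p k) (d k) (x k))"
proof -
  define N where "N = (\<lambda>k. pnorm (p k) (d k) (x k))"
  have N: "0 < N k" if "k < m" for k
    using nz that pnorm_pos unfolding N_def by blast
  define r where "r = (\<lambda>k j. \<bar>x k j\<bar> / (N k * maximizer k j))"
  have L: "0 < \<Lambda> xs" by (rule \<Lambda>_pos[OF xs_positive])
  have r0: "0 \<le> r k j" if "k < m" "j < d k" for k j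
    using N[OF that(1)] maximizer_pos[OF that] by (simp add: r_def)
  have "\<bar>feval f m d x\<bar> \<le> (\<Sum>J\<in>I. \<bar>f J * (\<Prod>k<m. x k (J k))\<bar>)"
    unfolding feval_def by (rule sum_abs)
  also have "\<dots> = (\<Sum>J\<in>I. (\<Prod>k<m. N k) / \<Lambda> xs powr (1 / p i) * (W xs J * (\<Prod>k<m. r k (J k))))"
  proof (intro sum.cong refl)
    fix J assume J: "J \<in> I"
    have "(\<Prod>k<m. \<bar>x k (J k)\<bar>) = (\<Prod>k<m. N k * maximizer k (J k) * r k (J k))"
    proof (intro prod.cong refl)
      fix k assume k: "k \<in> {..<m}"
      then show "\<bar>x k (J k)\<bar> = N k * maximizer k (J k) * r k (J k)"
        using N[of k] maximizer_pos[of k "J k"] multi_idx_less[OF J, of k] by (simp add: r_def)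
    qed
    then have "\<bar>f J * (\<Prod>k<m. x k (J k))\<bar> = (\<Prod>k<m. N k) * (f J * (\<Prod>k<m. maximizer k (J k))) * (\<Prod>k<m. r k (J k))"
      using fnonneg J by (simp add: abs_mult abs_prod prod.distrib mult_ac)
    then show "\<bar>f J * (\<Prod>k<m. x k (J k))\<bar> = (\<Prod>k<m. N k) / \<Lambda> xs powr (1 / p i) * (W xs J * (\<Prod>k<m. r k (J k)))"
      unfolding prod_maximizer[OF J] by simp
  qed
  also have "\<dots> = (\<Prod>k<m. N k) / \<Lambda> xs powr (1 / p i) * E (\<lambda>J. \<Prod>k<m. r k (J k))"
    by (simp add: E_def sum_distrib_left)
  also have "\<dots> \<le> (\<Prod>k<m. N k) / \<Lambda> xs powr (1 / p i) * \<Lambda> xs"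
  proof (rule mult_left_mono)
    have "E (\<lambda>J. \<Prod>k<m. r k (J k)) \<le> E (\<lambda>J. (\<Sum>k<m. r k (J k) powr p k / p k) + (1 - (\<Sum>k<m. 1 / p k)))"
      unfolding E_def
    proof (intro sum_mono mult_left_mono W_nonneg[OF xs_positive])
      fix J assume J: "J \<in> I"
      have "0 \<le> r k (J k)" "0 < p k" if "k < m" for k
        using r0[OF that multi_idx_less[OF J that]] prange[rule_format, OF that] by auto
      then show "(\<Prod>k<m. r k (J k)) \<le> (\<Sum>k<m. r k (J k) powr p k / p k) + (1 - (\<Sum>k<m. 1 / p k))"
        by (intro weighted_arith_geom_mean_le sum_inverse_exponents) auto
    qed
    also have "\<dots> = (\<Sum>k<m. E (\<lambda>J. r k (J k) powr p k / p k)) + (1 - (\<Sum>k<m. 1 / p k)) * \<Lambda> xs"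
    proof -
      have "E (\<lambda>J. 1 - (\<Sum>k<m. 1 / p k)) = (1 - (\<Sum>k<m. 1 / p k)) * \<Lambda> xs"
        unfolding E_def \<Lambda>_def sum_distrib_right[symmetric] by (rule mult.commute)
      then show ?thesis unfolding E_add E_sum by simp
    qed
    \<comment> \<open>The \<open>k\<close>-th marginal contains the power of
      \<open>maximizer\<close> that divides \<open>r\<close>, so what remains is the normalised
      power sum of \<open>x k\<close>, which is 1.\<close>
    also have "(\<Sum>k<m. E (\<lambda>J. r k (J k) powr p k / p k)) = (\<Sum>k<m. \<Lambda> xs * (1 / p k))"
    proof (intro sum.cong refl)
      fix k assume "k \<in> {..<m}"
      then have k: "k < m" "0 < p k" using prange by auto
      have "E (\<lambda>J. r k (J k) powr p k / p k) = (\<Sum>j<d k. marg xs k j * (r k j powr p k / p k))"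
        by (rule E_fun[OF k(1)])
      also have "\<dots> = (\<Sum>j<d k. \<bar>x k j\<bar> powr p k * (\<Lambda> xs / (N k powr p k * p k)))"
      proof (intro sum.cong refl)
        fix j assume "j \<in> {..<d k}"
        then have j: "j < d k" by simp
        have "0 < maximizer k j powr p k" using maximizer_pos[OF k(1) j] by simp
        then show "marg xs k j * (r k j powr p k / p k) = \<bar>x k j\<bar> powr p k * (\<Lambda> xs / (N k powr p k * p k))"
          using N[OF k(1)] maximizer_pos[OF k(1) j]
          by (simp add: marg_maximizer[OF k(1) j] r_def powr_divide powr_mult)
      qed
      also have "\<dots> = N k powr p k * (\<Lambda> xs / (N k powr p k * p k))"
        unfolding sum_distrib_right[symmetric] N_def pnorm_powr[OF k(2)] ..
      also have "\<dots> = \<Lambda> xs * (1 / p k)" using N[OF k(1)] by simp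
      finally show "E (\<lambda>J. r k (J k) powr p k / p k) = \<Lambda> xs * (1 / p k)" .
    qed
    also have "(\<Sum>k<m. \<Lambda> xs * (1 / p k)) + (1 - (\<Sum>k<m. 1 / p k)) * \<Lambda> xs = \<Lambda> xs"
      by (simp only: sum_distrib_left[symmetric]) (simp add: algebra_simps)
    finally show "E (\<lambda>J. \<Prod>k<m. r k (J k)) \<le> \<Lambda> xs" .
    show "0 \<le> (\<Prod>k<m. N k) / \<Lambda> xs powr (1 / p i)" using N by (auto intro!: divide_nonneg_nonneg prod_nonneg simp: less_imp_le)
  qed
  also have "\<dots> = \<Lambda> xs powr (1 / q) * (\<Prod>k<m. N k)" unfolding \<Lambda>_quotient[symmetric] by simp
  finally show ?thesis unfolding N_def .
qed

lemma tnorm_eq: "tnorm f m d p = \<Lambda> xs powr (1 / q)"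
  unfolding tnorm_def
proof (rule cSup_eq_maximum)
  have "maximizer \<in> space_full m d" by (auto simp: space_full_def maximizer_def)
  moreover have "\<forall>k<m. \<exists>j<d k. maximizer k j \<noteq> 0"
    using maximizer_pos[of _ 0] d_pos by (metis less_numeral_extra(3))
  moreover have "\<Lambda> xs powr (1 / q) = \<bar>feval f m d maximizer\<bar> / (\<Prod>k<m. pnorm (p k) (d k) (maximizer k))"
    by (simp add: feval_maximizer pnorm_maximizer)
  ultimately show "\<Lambda> xs powr (1 / q) \<in> {\<bar>feval f m d x\<bar> / (\<Prod>k<m. pnorm (p k) (d k) (x k)) |x.
      x \<in> space_full m d \<and> (\<forall>k<m. \<exists>j<d k. x k j \<noteq> 0)}" by blast
next
  fix y assume "y \<in> {\<bar>feval f m d x\<bar> / (\<Prod>k<m. pnorm (p k) (d k) (x k)) |x.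
      x \<in> space_full m d \<and> (\<forall>k<m. \<exists>j<d k. x k j \<noteq> 0)}"
  then obtain x where y: "y = \<bar>feval f m d x\<bar> / (\<Prod>k<m. pnorm (p k) (d k) (x k))"
    and nz: "\<forall>k<m. \<exists>j<d k. x k j \<noteq> 0" by blast
  have "0 < (\<Prod>k<m. pnorm (p k) (d k) (x k))"
  proof (rule prod_pos)
    fix k assume "k \<in> {..<m}"
    then obtain j where "j < d k" "x k j \<noteq> 0" using nz by blast
    then show "0 < pnorm (p k) (d k) (x k)" by (rule pnorm_pos)
  qed
  then show "y \<le> \<Lambda> xs powr (1 / q)" unfolding y using feval_le[OF nz] by (simp add: pos_divide_le_eq)
qed

section \<open>Limits along a sequence on the spheres converging to \<open>xs\<close>\<close>

lemma tendsto_grad: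
  assumes "\<And>l j. l < m \<Longrightarrow> l \<noteq> k \<Longrightarrow> j < d l \<Longrightarrow> (\<lambda>n. Z n l j) \<longlonglongrightarrow> z l j"
  shows "(\<lambda>n. gr k (Z n) j) \<longlonglongrightarrow> gr k z j"
  unfolding grad_def
  using assms multi_idx_less by (intro tendsto_intros) auto

context
  fixes X :: "nat \<Rightarrow> point"
  assumes XS: "\<And>n. X n \<in> S"
    and X: "\<And>k j. k \<in> L \<Longrightarrow> j < d k \<Longrightarrow> (\<lambda>n. X n k j) \<longlonglongrightarrow> xs k j"
begin

lemma tendsto_grad_i: "(\<lambda>n. gr i (X n) a) \<longlonglongrightarrow> gr i xs a"
  using X by (intro tendsto_grad) auto

lemma tendsto_s_map:
  assumes k: "k \<in> L" "j < d k"
  shows "(\<lambda>n. s_map f m d p i k (X n) j) \<longlonglongrightarrow> s_map f m d p i k xs j"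
proof -
  note pos = Spp_positive[OF XS] xs_positive
  have "(\<lambda>n. ext (X n) l j) \<longlonglongrightarrow> ext xs l j" if "l < m" "j < d l" for l j
  proof (cases "l = i")
    case True
    have "(\<lambda>n. gr i (X n) j powr (q - 1)) \<longlonglongrightarrow> gr i xs j powr (q - 1)"
      using gi_pos[OF xs_positive, of j] True that by (intro tendsto_powr tendsto_grad_i tendsto_const) auto
    then show ?thesis using True that pos by (simp add: ext_simps)
  next
    case False
    then show ?thesis using X that by (simp add: ext_simps)
  qed
  then have "(\<lambda>n. gr k (ext (X n)) j) \<longlonglongrightarrow> gr k (ext xs) j" by (intro tendsto_grad) auto
  then have "(\<lambda>n. gr k (ext (X n)) j powr (1 / (p k - 1))) \<longlonglongrightarrow> gr k (ext xs) j powr (1 / (p k - 1))"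
    using grad_ext_pos[OF xs_positive, of k j] k by (intro tendsto_powr tendsto_const) auto
  then show ?thesis using pos k by (simp add: s_map_eq)
qed

text \<open>The ratios in mode \<open>l\<close> tend to
  \<open>\<Lambda> xs powr (1 / (p l - 1))\<close>. The exponent in the bounds makes this limit
  independent of \<open>l\<close> and \<open>j\<close>, so minima and maxima share it, and the
  \<open>m - 1\<close> factors multiply to \<open>\<Lambda> xs powr (1 / q)\<close>.\<close>

lemma tendsto_lam:
  "(\<lambda>n. hgpm_lam_minus f m d p i (X n)) \<longlonglongrightarrow> \<Lambda> xs powr (1 / q)"
  "(\<lambda>n. hgpm_lam_plus f m d p i (X n)) \<longlonglongrightarrow> \<Lambda> xs powr (1 / q)"
proof -
  let ?b = "\<Lambda> xs powr (1 / (q * (real m - 1)))"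
  have L: "0 < \<Lambda> xs" by (rule \<Lambda>_pos[OF xs_positive])
  have lim: "(\<lambda>n. (s_map f m d p i l (X n) j / X n l j) powr ((p l - 1) / (hoelder_conj (p i) * (real m - 1)))) \<longlonglongrightarrow> ?b"
    if l: "l \<in> L" "j < d l" for l j
  proof -
    let ?u = "(p l - 1) / (q * (real m - 1))"
    have r: "s_map f m d p i l xs j / xs l j = \<Lambda> xs powr (1 / (p l - 1))"
      using xs_pos[OF l] by (simp add: s_map_xs[OF l])
    have "(\<lambda>n. (s_map f m d p i l (X n) j / X n l j) powr ?u) \<longlonglongrightarrow> (s_map f m d p i l xs j / xs l j) powr ?u"
      using xs_pos[OF l] s_map_pos[OF xs_positive l]
      by (intro tendsto_powr tendsto_divide tendsto_const tendsto_s_map l X) auto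
    moreover have "(s_map f m d p i l xs j / xs l j) powr ?u = ?b"
      unfolding r powr_powr using p_gt_1[OF l(1)] by simp
    ultimately show ?thesis by (simp add: q_def)
  qed
  have "(\<Prod>l\<in>L. ?b) = \<Lambda> xs powr (real (card L) * (1 / (q * (real m - 1))))"
    using L by (simp only: prod_constant powr_realpow[symmetric] powr_powr powr_gt_zero) (simp add: mult.commute)
  also have "\<dots> = \<Lambda> xs powr (1 / q)" unfolding card_L using m2 by simp
  finally have P: "(\<Prod>l\<in>L. ?b) = \<Lambda> xs powr (1 / q)" .
  have "{..<d l} \<noteq> {}" if "l \<in> L" for l using d_pos[of l] that by auto
  then show "(\<lambda>n. hgpm_lam_minus f m d p i (X n)) \<longlonglongrightarrow> \<Lambda> xs powr (1 / q)"
    "(\<lambda>n. hgpm_lam_plus f m d p i (X n)) \<longlonglongrightarrow> \<Lambda> xs powr (1 / q)"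
    unfolding hgpm_lam_minus_def hgpm_lam_plus_def P[symmetric]
    by (intro tendsto_prod tendsto_Min_Max_image lim; simp)+
qed

lemma tendsto_Qfun: "(\<lambda>n. Qfun f m d p i (X n)) \<longlonglongrightarrow> \<Lambda> xs powr (1 / q)"
proof -
  have "Qfun f m d p i (X n) = (\<Sum>a<d i. \<bar>gr i (X n) a\<bar> powr q) powr (1 / q)" for n
  proof -
    have "pnorm (p k) (d k) (X n k) = 1" if "k \<in> L" for k
      using XS[of n] that by (auto simp: sphere_Spp_def sphere_S_def)
    then show ?thesis by (simp add: Qfun_def pnorm_def[of q] q_def[symmetric])
  qed
  moreover have "(\<Sum>a<d i. \<bar>gr i xs a\<bar> powr q) = \<Lambda> xs"
    using gi_pos[OF xs_positive] by (auto simp: \<Lambda>_eq[OF xs_positive] less_imp_le intro!: sum.cong)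
  moreover have "(\<lambda>n. (\<Sum>a<d i. \<bar>gr i (X n) a\<bar> powr q) powr (1 / q)) \<longlonglongrightarrow> (\<Sum>a<d i. \<bar>gr i xs a\<bar> powr q) powr (1 / q)"
  proof (intro tendsto_powr tendsto_sum tendsto_rabs tendsto_grad_i tendsto_const)
    fix a assume "a \<in> {..<d i}"
    then show "\<bar>gr i xs a\<bar> \<noteq> 0" using gi_pos[OF xs_positive, of a] by simp
  next
    show "(\<Sum>a<d i. \<bar>gr i xs a\<bar> powr q) \<noteq> 0" using calculation(2) \<Lambda>_pos[OF xs_positive] by simp
  qed
  ultimately show ?thesis by simp
qed

end

end

theorem theorem7:
  fixes f :: "(nat \<Rightarrow> nat) \<Rightarrow> real" and m :: nat and d :: "nat \<Rightarrow> nat"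
    and p :: "nat \<Rightarrow> real" and i :: nat and xstar x0 :: point
  assumes m2: "m \<ge> 2"
    and dpos: "\<forall>k<m. d k \<ge> 1"
    and fnonneg: "\<forall>J\<in>multi_idx m d. f J \<ge> 0"
    and wirr: "weakly_irreducible f m d"
    and prange: "\<forall>k<m. 1 < p k"
    and im: "i < m"
    and pcond: "\<forall>k<m. k \<noteq> i \<longrightarrow> (real m - 1) * hoelder_conj (p i) \<le> p k"
    and pcond2: "m = 2 \<longrightarrow> (\<forall>k<m. k \<noteq> i \<longrightarrow> p i \<le> p k)"
    and xstar_pos: "xstar \<in> sphere_Spp m d p i"
    and xstar_crit: "critical_Q f m d p i xstar"
    and x0: "x0 \<in> sphere_Spp m d p i"
  shows "(\<forall>k j. (\<lambda>n. hgpm_x f m d p i x0 n k j) \<longlonglongrightarrow> xstar k j)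
    \<and> ((\<lambda>n. hgpm_lam_minus f m d p i (hgpm_x f m d p i x0 n)) \<longlonglongrightarrow> tnorm f m d p)
    \<and> ((\<lambda>n. hgpm_lam_plus f m d p i (hgpm_x f m d p i x0 n)) \<longlonglongrightarrow> tnorm f m d p)
    \<and> ((\<lambda>n. Qfun f m d p i (hgpm_x f m d p i x0 n)) \<longlonglongrightarrow> tnorm f m d p)
    \<and> (\<exists>G \<nu> k0. is_norm_on (space_R m d i) G \<and> 0 < \<nu> \<and> \<nu> < 1 \<and>
         (\<forall>k\<ge>k0. G (\<lambda>l j. hgpm_x f m d p i x0 (Suc k) l j - xstar l j)
                 \<le> \<nu> * G (\<lambda>l j. hgpm_x f m d p i x0 k l j - xstar l j)))"
proof -
  interpret critical_point f m d p i xstar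
    by unfold_locales (use assms in blast)+
  let ?x = "hgpm_x f m d p i x0"
  have S: "?x n \<in> S" for n using x0 by (rule iterates_Spp)
  have conv: "conv x0" using x0 Spp_positive global_convergence by blast
  have lim: "(\<lambda>n. ?x n k j) \<longlonglongrightarrow> xstar k j" for k j
  proof (cases "k \<in> L \<and> j < d k")
    case True
    then show ?thesis using conv unfolding conv_def by blast
  next
    case False
    then have "?x n k j = 0" "xstar k j = 0" for n
      using S[of n] xstar_pos by (auto simp: sphere_Spp_def sphere_S_def space_R_def)
    then show ?thesis by simp
  qed
  obtain \<delta> \<nu> where \<delta>: "0 < \<delta>" and \<nu>: "0 < \<nu>" "\<nu> < 1"
    and contr: "\<And>x. x \<in> S \<Longrightarrow> G (\<lambda>k j. x k j - xstar k j) < \<delta> \<Longrightarrow>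
      G (\<lambda>k j. H x k j - xstar k j) \<le> \<nu> * G (\<lambda>k j. x k j - xstar k j)"
    using local_contraction by blast
  \<comment> \<open>Global convergence brings the iterates permanently into the ball where the local
    contraction applies.\<close>
  obtain k0 where k0: "\<And>n. k0 \<le> n \<Longrightarrow> G (\<lambda>k j. ?x n k j - xstar k j) < \<delta>"
    using order_tendstoD(2)[OF G_tendsto_0[OF conv] \<delta>] unfolding eventually_sequentially by blast
  have "\<forall>k\<ge>k0. G (\<lambda>l j. ?x (Suc k) l j - xstar l j) \<le> \<nu> * G (\<lambda>l j. ?x k l j - xstar l j)"
    using contr[OF S k0] by simp
  then have "\<exists>G \<nu> k0. is_norm_on (space_R m d i) G \<and> 0 < \<nu> \<and> \<nu> < 1 \<and>
      (\<forall>k\<ge>k0. G (\<lambda>l j. ?x (Suc k) l j - xstar l j) \<le> \<nu> * G (\<lambda>l j. ?x k l j - xstar l j))"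
    using is_norm_on_G \<nu> by blast
  then show ?thesis
    using lim tendsto_lam[OF S lim] tendsto_Qfun[OF S lim] unfolding tnorm_eq by blast
qed

end
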